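(* (a) Let $Sys$ be a finite set of quantum systems, $C'\subseteq C\subseteq Sys$, $L$ a set of labels, and $\rho\in\mathrm{DM}(\mathcal{H}_{C'})$. Let $(X,c)$, $(Y,d)$ be qLTSs $c:X\to\mathcal{P}(Q_CX)^L$, $d:Y\to\mathcal{P}(Q_CY)^L$, and $s\in X$, $t\in Y$ with $s\sim_k t$. Then $s\sim_k t$ in the partial evaluations $\downarrow_\rho(X,c)$ and $\downarrow_\rho(Y,d)$ (coalgebras for $\mathcal{P}(Q_{C\setminus C'}-)^L$). (b) Let $\{T_m\}$ be an extensible $M$-graded monad on $\mathbf{Set}$, $m\perp n$, and $\alpha:T_mX\times T_nY\to T_{m+n}(X\times Y)$ natural. Let $(X,c),(Y,d)$ be $\mathcal{P}(T_m-)^L$-coalgebras with $s\in X$, $t\in Y$, $s\sim_k t$, and $(X',c'),(Y',d')$ be $\mathcal{P}(T_n-)^L$-coalgebras with $s'\in X'$, $t'\in Y'$, $s'\sim_k t'$. Then $(s,s')\sim_k(t,t')$ in $(X,c)\parallel(X',c')$ and $(Y,d)\parallel(Y',d')$.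
   Context: Quantum setting: each $S\in Sys$ has a finite-dimensional Hilbert space $\mathcal{H}_S$; $\mathcal{H}_\emptyset=\mathbb{C}$ and $\mathcal{H}_C=\bigotimes_{S\in C}\mathcal{H}_S$ with Kronecker factors ordered by index. $\mathrm{Ef}(\mathcal{H})=\{L:0\sqsubseteq L\sqsubseteq\mathbb{I}\}$ (Löwner order) is an effect algebra with matrix sum defined iff $\sqsubseteq\mathbb{I}$, zero matrix and $L'=\mathbb{I}-L$; $\mathrm{DM}(\mathcal{H})$ is the set of positive semidefinite trace-one matrices. For an effect algebra $\mathbb{E}$, $D_{\mathbb{E}}X$ is the set of finitely supported $\Delta:X\to\mathbb{E}$ whose sum over the support is defined, $(D_{\mathbb{E}}f)(\Delta)(y)=\sum_{x\in f^{-1}(y)}\Delta(x)$; $Q_C=D_{\mathrm{Ef}(\mathcal{H}_C)}$. For disjoint $A,B$, $L_1\boxtimes L_2=\mathrm{Sort}_{A,B}(L_1\otimes L_2)$, the Kronecker product with factors permuted (by conjugation with the permutation unitary) from $\mathcal{H}_A\otimes\mathcal{H}_B$ into $\mathcal{H}_{A\cup B}$. The partial evaluation map is $p_\rho:\mathrm{Ef}(\mathcal{H}_C)\to\mathrm{Ef}(\mathcal{H}_{C\setminus C'})$, $p_\rho(L)=\mathrm{tr}_{C'}(L(\rho\boxtimes\mathbb{I}))$, with $\mathbb{I}$ the identity on $\mathcal{H}_{C\setminus C'}$ and $\mathrm{tr}_{C'}$ the partial trace over $\mathcal{H}_{C'}$; $\downarrow_\rho(X,c)=(X,c_\rho)$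 with $c_\rho(x)(\mu)=\{p_\rho\circ\Delta:\Delta\in c(x)(\mu)\}$. $\mathcal{P}$ is the finite powerset functor, $\mathcal{P}(F-)^L$ is $X\mapsto\mathcal{P}(FX)^L$ acting labelwise by direct image. Coalgebra homomorphisms $f:(X,c)\to(Y,d)$ for $G$ satisfy $Gf\circ c=d\circ f$. Kernel bisimilarity: $x\sim_k y$ iff there is a cospan $X\xrightarrow{m_1}Z\xleftarrow{m_2}Y$ and coalgebra $(Z,e)$ making $m_1,m_2$ homomorphisms, with $m_1(x)=m_2(y)$. Graded setting: a PCM $\langle M,0,+\rangle$ ($m\perp n$ iff $m+n$ defined; $a\preceq b$ iff $a+c=b$ for some $c$). An $M$-graded monad: endofunctors $T_m$, natural $\eta:\mathrm{Id}\to T_0$, natural $\mu_{m,n}:T_mT_n\to T_{m+n}$, associative and unital; extensible: natural $\xi_{m\preceq n}:T_m\to T_n$, $\xi_{m\preceq m}=\mathrm{Id}$, $\xi_{n\preceq o}\circ\xi_{m\preceq n}=\xi_{m\preceq o}$. The synchronization $c\,|\,d:X\times Y\to\mathcal{P}(T_mX\times T_nY)^L$ of $c:X\to\mathcal{P}(T_mX)^L$, $d:Y\to\mathcal{P}(T_nY)^L$ (writing $s\xrightarrow{\mu}\Delta$ for $\Delta\in c(s)(\mu)$, with a silent label $\tau\in L$ and an involution $\mu\mapsto\overline\mu$ on other labels) is the least transition function with: $s\xrightarrow{\mu}\Delta$ gives $(s,t)\xrightarrow{\mu}\langle\Delta,\xi_{0\preceq n}(\eta(t))\rangle$; $t\xrightarrow{\mu}\Theta$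 gives $(s,t)\xrightarrow{\mu}\langle\xi_{0\preceq m}(\eta(s)),\Theta\rangle$; $s\xrightarrow{\mu}\Delta$ and $t\xrightarrow{\overline\mu}\Theta$ give $(s,t)\xrightarrow{\tau}\langle\Delta,\Theta\rangle$. Then $(X,c)\parallel(Y,d)=(X\times Y,\mathcal{P}(\alpha)^L\circ(c\,|\,d))$.
   Formalization: In (b) it is additionally assumed that both synchronizations c|c' and d|d' are finitely branching, so that they have values in the finite powerset; this is automatic for finite L, but for infinite L the τ-rule can yield infinitely many successors and the composition is then undefined. *)

theory Defs
  imports
    "Jordan_Normal_Form.Schur_Decomposition"
    "HOL-Library.FuncSet"
    "HOL-Library.Nat_Bijection"
begin

section \<open>The category of sets\<close>

text \<open>
  HOL cannot quantify over endofunctors on all types, nor existentially over a type. The category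
  \<open>Set\<close> is therefore rendered as the full category of sets belonging to a universe \<open>U\<close> of subsets of a
  type \<open>'u\<close>, with extensional functions as morphisms. Only closure properties that hold for the
  small sets of any model of ZF are required; so every Grothendieck universe is an instance, and
  so is the collection of all subsets of an arbitrary infinite type. \<open>pr\<close> codes ordered pairs, so that
  binary products exist in \<open>U\<close>.
\<close>

definition cprod :: "('u \<times> 'u \<Rightarrow> 'u) \<Rightarrow> 'u set \<Rightarrow> 'u set \<Rightarrow> 'u set" where
  "cprod pr X Y = pr ` (X \<times> Y)"

locale set_universe =
  fixes U :: "'u set set" and pr :: "'u \<times> 'u \<Rightarrow> 'u"
  assumes inj_pr: "inj pr"
    and subset_closed: "X \<in> U \<Longrightarrow> Y \<subseteq> X \<Longrightarrow> Y \<in> U"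
    and image_closed: "X \<in> U \<Longrightarrow> f ` X \<in> U"
    and union_closed: "X \<in> U \<Longrightarrow> Y \<in> U \<Longrightarrow> X \<union> Y \<in> U"
    and cprod_closed: "X \<in> U \<Longrightarrow> Y \<in> U \<Longrightarrow> cprod pr X Y \<in> U"
    and infinite_member: "\<exists>X\<in>U. infinite X"

lemma set_universe_nat: "set_universe UNIV prod_encode"
  by standard (auto simp: inj_prod_encode intro: exI[of _ "UNIV :: nat set"])

definition cprod_map ::
  "('u \<times> 'u \<Rightarrow> 'u) \<Rightarrow> 'u set \<Rightarrow> 'u set \<Rightarrow> ('u \<Rightarrow> 'u) \<Rightarrow> ('u \<Rightarrow> 'u) \<Rightarrow> 'u \<Rightarrow> 'u" where
  "cprod_map pr X Y f g = (\<lambda>p\<in>cprod pr X Y. case inv_into UNIV pr p of (x, y) \<Rightarrow> pr (f x, g y))"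

text \<open>The action \<open>mor F X Y f\<close> on a morphism \<open>f : X \<rightarrow> Y\<close> takes domain and codomain explicitly. The
  values of a functor may live in a type \<open>'v\<close> other than \<open>'u\<close>.\<close>

record ('u, 'v) set_functor =
  obj :: "'u set \<Rightarrow> 'v set"
  mor :: "'u set \<Rightarrow> 'u set \<Rightarrow> ('u \<Rightarrow> 'u) \<Rightarrow> 'v \<Rightarrow> 'v"

locale endofunctor =
  fixes U :: "'u set set" and F :: "('u, 'u) set_functor"
  assumes obj_closed: "X \<in> U \<Longrightarrow> obj F X \<in> U"
    and mor_type: "\<lbrakk>X \<in> U; Y \<in> U; f \<in> X \<rightarrow>\<^sub>E Y\<rbrakk> \<Longrightarrow> mor F X Y f \<in> obj F X \<rightarrow>\<^sub>E obj F Y"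
    and mor_id: "X \<in> U \<Longrightarrow> mor F X X (\<lambda>x\<in>X. x) = (\<lambda>z\<in>obj F X. z)"
    and mor_comp: "\<lbrakk>X \<in> U; Y \<in> U; Z \<in> U; f \<in> X \<rightarrow>\<^sub>E Y; g \<in> Y \<rightarrow>\<^sub>E Z\<rbrakk> \<Longrightarrow>
      mor F X Z (compose X g f) = compose (obj F X) (mor F Y Z g) (mor F X Y f)"


section \<open>Coalgebras and kernel bisimilarity\<close>

definition coalgebra ::
  "'u set set \<Rightarrow> ('u, 'w) set_functor \<Rightarrow> 'u set \<times> ('u \<Rightarrow> 'w) \<Rightarrow> bool" where
  "coalgebra U G = (\<lambda>(X, c). X \<in> U \<and> c \<in> X \<rightarrow>\<^sub>E obj G X)"

definition coalgebra_hom ::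
  "'u set set \<Rightarrow> ('u, 'w) set_functor \<Rightarrow> ('u \<Rightarrow> 'u) \<Rightarrow>
   'u set \<times> ('u \<Rightarrow> 'w) \<Rightarrow> 'u set \<times> ('u \<Rightarrow> 'w) \<Rightarrow> bool" where
  "coalgebra_hom U G f = (\<lambda>(X, c) (Y, d).
     coalgebra U G (X, c) \<and> coalgebra U G (Y, d) \<and> f \<in> X \<rightarrow>\<^sub>E Y \<and>
     (\<forall>x\<in>X. mor G X Y f (c x) = d (f x)))"

definition kernel_bisimilar ::
  "'u set set \<Rightarrow> ('u, 'w) set_functor \<Rightarrow>
   'u set \<times> ('u \<Rightarrow> 'w) \<Rightarrow> 'u set \<times> ('u \<Rightarrow> 'w) \<Rightarrow> 'u \<Rightarrow> 'u \<Rightarrow> bool" where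
  "kernel_bisimilar U G A B x y \<longleftrightarrow> x \<in> fst A \<and> y \<in> fst B \<and>
     (\<exists>Z e m1 m2. coalgebra_hom U G m1 A (Z, e) \<and> coalgebra_hom U G m2 B (Z, e) \<and> m1 x = m2 y)"

text \<open>Labelwise direct image, and the functor \<open>\<P>(F-)\<^sup>L\<close> (\<^const>\<open>Fpow\<close> is the set of finite subsets).\<close>

definition lts_map :: "'l set \<Rightarrow> ('v \<Rightarrow> 'w) \<Rightarrow> ('l \<Rightarrow> 'v set) \<Rightarrow> 'l \<Rightarrow> 'w set" where
  "lts_map L g \<phi> = (\<lambda>\<mu>\<in>L. g ` \<phi> \<mu>)"

definition lts_functor ::
  "'l set \<Rightarrow> ('u, 'v) set_functor \<Rightarrow> ('u, 'l \<Rightarrow> 'v set) set_functor" where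
  "lts_functor L F =
     \<lparr> obj = (\<lambda>X. L \<rightarrow>\<^sub>E Fpow (obj F X)),
       mor = (\<lambda>X Y f. \<lambda>\<phi>\<in>(L \<rightarrow>\<^sub>E Fpow (obj F X)). lts_map L (mor F X Y f) \<phi>) \<rparr>"


section \<open>Partial commutative monoids and effect algebras\<close>

text \<open>\<open>padd M a b\<close> is meaningful only if \<open>perp M a b\<close>.\<close>

record 'a pcm =
  elems :: "'a set"
  pzero :: 'a
  perp :: "'a \<Rightarrow> 'a \<Rightarrow> bool"
  padd :: "'a \<Rightarrow> 'a \<Rightarrow> 'a"

locale pcm =
  fixes M :: "('a, 'b) pcm_scheme"
  assumes zero_elem: "pzero M \<in> elems M"
    and perp_elems: "perp M a b \<Longrightarrow> a \<in> elems M \<and> b \<in> elems M"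
    and add_elem: "perp M a b \<Longrightarrow> padd M a b \<in> elems M"
    and comm: "perp M a b \<Longrightarrow> perp M b a \<and> padd M b a = padd M a b"
    and assoc: "perp M a b \<Longrightarrow> perp M (padd M a b) c \<Longrightarrow>
      perp M b c \<and> perp M a (padd M b c) \<and> padd M a (padd M b c) = padd M (padd M a b) c"
    and zero_add: "a \<in> elems M \<Longrightarrow> perp M (pzero M) a \<and> padd M (pzero M) a = a"

definition preceq :: "('a, 'b) pcm_scheme \<Rightarrow> 'a \<Rightarrow> 'a \<Rightarrow> bool" where
  "preceq M a b \<longleftrightarrow> (\<exists>c\<in>elems M. perp M a c \<and> padd M a c = b)"

record 'a effect_algebra = "'a pcm" +
  ortho :: "'a \<Rightarrow> 'a"

locale effect_algebra = pcm E for E :: "('a, 'b) effect_algebra_scheme" +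
  assumes ortho_elem: "a \<in> elems E \<Longrightarrow> ortho E a \<in> elems E"
    and ortho_iff: "a \<in> elems E \<Longrightarrow> b \<in> elems E \<Longrightarrow>
      perp E a b \<and> padd E a b = ortho E (pzero E) \<longleftrightarrow> b = ortho E a"
    and perp_one: "perp E a (ortho E (pzero E)) \<Longrightarrow> a = pzero E"

text \<open>\<open>psum E \<Delta> S a\<close>: the partial sum of \<open>\<Delta>\<close> over the finite set \<open>S\<close> is defined and equals \<open>a\<close>.\<close>

inductive psum :: "('a, 'b) pcm_scheme \<Rightarrow> ('x \<Rightarrow> 'a) \<Rightarrow> 'x set \<Rightarrow> 'a \<Rightarrow> bool"
  for E :: "('a, 'b) pcm_scheme" and \<Delta> :: "'x \<Rightarrow> 'a" where
  "psum E \<Delta> {} (pzero E)"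
| "psum E \<Delta> S a \<Longrightarrow> x \<notin> S \<Longrightarrow> perp E a (\<Delta> x) \<Longrightarrow> psum E \<Delta> (insert x S) (padd E a (\<Delta> x))"

definition psum_val :: "('a, 'b) pcm_scheme \<Rightarrow> ('x \<Rightarrow> 'a) \<Rightarrow> 'x set \<Rightarrow> 'a" where
  "psum_val E \<Delta> S = (THE a. psum E \<Delta> S a)"

definition supp :: "('a, 'b) pcm_scheme \<Rightarrow> 'x set \<Rightarrow> ('x \<Rightarrow> 'a) \<Rightarrow> 'x set" where
  "supp E X \<Delta> = {x \<in> X. \<Delta> x \<noteq> pzero E}"

definition dist :: "('a, 'b) pcm_scheme \<Rightarrow> 'x set \<Rightarrow> ('x \<Rightarrow> 'a) set" where
  "dist E X = {\<Delta> \<in> X \<rightarrow>\<^sub>E elems E. finite (supp E X \<Delta>) \<and> (\<exists>a. psum E \<Delta> (supp E X \<Delta>) a)}"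

definition dist_functor :: "('a, 'b) pcm_scheme \<Rightarrow> ('u, 'u \<Rightarrow> 'a) set_functor" where
  "dist_functor E =
     \<lparr> obj = dist E,
       mor = (\<lambda>X Y f. \<lambda>\<Delta>\<in>dist E X. \<lambda>y\<in>Y. psum_val E \<Delta> {x \<in> supp E X \<Delta>. f x = y}) \<rparr>"


section \<open>Effects and density matrices\<close>

text \<open>The order on \<^typ>\<open>complex\<close> makes \<open>0 \<le> z\<close> mean that \<open>z\<close> is real and nonnegative.\<close>

definition psd :: "nat \<Rightarrow> complex mat \<Rightarrow> bool" where
  "psd n A \<longleftrightarrow> A \<in> carrier_mat n n \<and> mat_adjoint A = A \<and>
     (\<forall>v\<in>carrier_vec n. 0 \<le> (A *\<^sub>v v) \<bullet>c v)"

definition loewner_le :: "nat \<Rightarrow> complex mat \<Rightarrow> complex mat \<Rightarrow> bool" where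
  "loewner_le n A B \<longleftrightarrow> A \<in> carrier_mat n n \<and> B \<in> carrier_mat n n \<and> psd n (B - A)"

definition effects :: "nat \<Rightarrow> complex mat set" where
  "effects n = {A. loewner_le n (0\<^sub>m n n) A \<and> loewner_le n A (1\<^sub>m n)}"

definition Ef :: "nat \<Rightarrow> complex mat effect_algebra" where
  "Ef n =
     \<lparr> elems = effects n,
       pzero = 0\<^sub>m n n,
       perp = (\<lambda>A B. A \<in> effects n \<and> B \<in> effects n \<and> loewner_le n (A + B) (1\<^sub>m n)),
       padd = (+),
       ortho = (\<lambda>A. 1\<^sub>m n - A) \<rparr>"

lemma mat_adjoint_index:
  assumes "A \<in> carrier_mat n m" "i < m" "j < n"
  shows "mat_adjoint A $$ (i, j) = cnj (A $$ (j, i))"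
  using assms by (auto simp: mat_adjoint_def mat_of_rows_def cols_def)

lemma mat_adjoint_carrier: "A \<in> carrier_mat n m \<Longrightarrow> mat_adjoint A \<in> carrier_mat m n"
  by (auto simp: mat_adjoint_def mat_of_rows_def)

lemma mat_adjoint_eq_iff:
  assumes "A \<in> carrier_mat n n"
  shows "mat_adjoint A = A \<longleftrightarrow> (\<forall>i<n. \<forall>j<n. A $$ (i, j) = cnj (A $$ (j, i)))"
proof (intro iffI allI impI)
  fix i j assume "mat_adjoint A = A" "i < n" "j < n"
  then show "A $$ (i, j) = cnj (A $$ (j, i))"
    using mat_adjoint_index[OF assms, of i j] by simp
next
  assume h: "\<forall>i<n. \<forall>j<n. A $$ (i, j) = cnj (A $$ (j, i))"
  show "mat_adjoint A = A"
  proof (rule eq_matI)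
    fix i j assume "i < dim_row A" "j < dim_col A"
    then have ij: "i < n" "j < n" using assms by auto
    have "mat_adjoint A $$ (i, j) = cnj (A $$ (j, i))"
      by (rule mat_adjoint_index[OF assms ij])
    also have "\<dots> = A $$ (i, j)" using h[rule_format, OF ij] by (rule sym)
    finally show "mat_adjoint A $$ (i, j) = A $$ (i, j)" .
  qed (use assms mat_adjoint_carrier[OF assms] in auto)
qed

lemma quad_sum:
  assumes "A \<in> carrier_mat n n" "v \<in> carrier_vec n"
  shows "(A *\<^sub>v v) \<bullet>c v = (\<Sum>i<n. \<Sum>j<n. A $$ (i, j) * v $ j * cnj (v $ i))"
  using assms by (auto simp: scalar_prod_def sum_distrib_right lessThan_atLeast0 intro!: sum.cong)

lemma psd_iff:
  "psd n A \<longleftrightarrow> A \<in> carrier_mat n n \<and> (\<forall>i<n. \<forall>j<n. A $$ (i, j) = cnj (A $$ (j, i))) \<and>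
     (\<forall>v\<in>carrier_vec n. 0 \<le> (\<Sum>i<n. \<Sum>j<n. A $$ (i, j) * v $ j * cnj (v $ i)))"
  unfolding psd_def by (intro conj_cong ball_cong refl) (simp_all only: mat_adjoint_eq_iff quad_sum)

lemma mat_adjoint_add:
  fixes A B :: "complex mat"
  assumes "A \<in> carrier_mat n n" "B \<in> carrier_mat n n"
  shows "mat_adjoint (A + B) = mat_adjoint A + mat_adjoint B"
proof (rule eq_matI)
  have AB: "A + B \<in> carrier_mat n n" using assms by simp
  note c = mat_adjoint_carrier[OF AB] mat_adjoint_carrier[OF assms(1)] mat_adjoint_carrier[OF assms(2)]
  show "dim_row (mat_adjoint (A + B)) = dim_row (mat_adjoint A + mat_adjoint B)"
    "dim_col (mat_adjoint (A + B)) = dim_col (mat_adjoint A + mat_adjoint B)"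
    using c by auto
  fix i j assume "i < dim_row (mat_adjoint A + mat_adjoint B)" "j < dim_col (mat_adjoint A + mat_adjoint B)"
  then have ij: "i < n" "j < n" using c by auto
  have "(mat_adjoint A + mat_adjoint B) $$ (i, j) = mat_adjoint A $$ (i, j) + mat_adjoint B $$ (i, j)"
    using c ij by auto
  then show "mat_adjoint (A + B) $$ (i, j) = (mat_adjoint A + mat_adjoint B) $$ (i, j)"
    unfolding mat_adjoint_index[OF AB ij] mat_adjoint_index[OF assms(1) ij]
      mat_adjoint_index[OF assms(2) ij] using assms ij by simp
qed

lemma psd_add: "psd n A \<Longrightarrow> psd n B \<Longrightarrow> psd n (A + B)"
  unfolding psd_def
  by (auto simp: mat_adjoint_add add_mult_distrib_mat_vec[where nr = n and nc = n]
      add_scalar_prod_distrib[where n = n] intro: add_nonneg_nonneg)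

lemma psd_zero: "psd n (0\<^sub>m n n)"
  unfolding psd_iff by auto

lemma psd_one: "psd n (1\<^sub>m n)"
proof -
  have "(\<Sum>i<n. \<Sum>j<n. (1\<^sub>m n :: complex mat) $$ (i, j) * v $ j * cnj (v $ i)) = (\<Sum>i<n. v $ i * cnj (v $ i))" for v
    by (intro sum.cong) (auto simp: if_distrib if_distribR sum.delta cong: if_cong)
  then show ?thesis unfolding psd_iff
    by (auto intro!: add_nonneg_nonneg sum_nonneg simp: complex_mult_cnj less_eq_complex_def)
qed

lemma psd_antisym:
  assumes A: "psd n A" and B: "psd n (- A)"
  shows "A = 0\<^sub>m n n"
proof -
  have C: "A \<in> carrier_mat n n" using A psd_def by auto
  let ?q = "\<lambda>v. \<Sum>i<n. \<Sum>j<n. A $$ (i, j) * v $ j * cnj (v $ i)"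
  have q0: "?q v = 0" if "v \<in> carrier_vec n" for v
  proof -
    have "0 \<le> ?q v" using A that unfolding psd_iff by blast
    moreover have "0 \<le> (\<Sum>i<n. \<Sum>j<n. (- A) $$ (i, j) * v $ j * cnj (v $ i))"
      using B that unfolding psd_iff by blast
    then have "0 \<le> - ?q v" using C by (auto simp: sum_negf)
    ultimately show ?thesis by (simp add: less_eq_complex_def complex_eq_iff)
  qed
  have "A $$ (k, l) = 0" if k: "k < n" and l: "l < n" for k l
  proof -
    define e where "e a b = vec n (\<lambda>i. (if i = k then a else 0) + (if i = l then b else (0::complex)))" for a b
    have qe: "?q (e a b) = A $$ (k, k) * a * cnj a + A $$ (k, l) * b * cnj a +
        A $$ (l, k) * a * cnj b + A $$ (l, l) * b * cnj b" for a b
    proof -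
      have delta: "(\<Sum>j<n. f j * ((if j = k then x else 0) + (if j = l then y else 0))) = f k * x + f l * y"
        for f :: "nat \<Rightarrow> complex" and x y
        using k l by (simp add: distrib_left sum.distrib if_distrib[of "(*) _"] cong: if_cong)
      have "?q (e a b) = (\<Sum>i<n. \<Sum>j<n. A $$ (i, j) * ((if j = k then a else 0) + (if j = l then b else 0)) *
          ((if i = k then cnj a else 0) + (if i = l then cnj b else 0)))"
        by (intro sum.cong refl) (auto simp: e_def)
      also have "\<dots> = (\<Sum>i<n. (A $$ (i, k) * a + A $$ (i, l) * b) *
          ((if i = k then cnj a else 0) + (if i = l then cnj b else 0)))"
        by (simp only: sum_distrib_right[symmetric] delta)
      also have "\<dots> = (A $$ (k, k) * a + A $$ (k, l) * b) * cnj a + (A $$ (l, k) * a + A $$ (l, l) * b) * cnj b"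
        by (simp only: delta)
      finally show ?thesis by (simp add: algebra_simps)
    qed
    have z: "A $$ (k, k) * a * cnj a + A $$ (k, l) * b * cnj a +
        A $$ (l, k) * a * cnj b + A $$ (l, l) * b * cnj b = 0" for a b
      using q0[of "e a b"] unfolding qe by (simp add: e_def)
    have "A $$ (k, k) = 0" "A $$ (l, l) = 0" using z[of 1 0] z[of 0 1] by auto
    then show ?thesis using z[of 1 1] z[of 1 \<i>] by (auto simp: complex_eq_iff)
  qed
  then show ?thesis using C by (intro eq_matI) auto
qed

lemma effects_iff: "A \<in> effects n \<longleftrightarrow> A \<in> carrier_mat n n \<and> psd n A \<and> psd n (1\<^sub>m n - A)"
proof (cases "A \<in> carrier_mat n n")
  case True
  then have "A - 0\<^sub>m n n = A" by auto
  with True show ?thesis by (auto simp: effects_def loewner_le_def)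
qed (auto simp: effects_def loewner_le_def)

lemma effect_algebra_Ef: "effect_algebra (Ef n)"
proof -
  let ?p = "\<lambda>A B. perp (Ef n) A B"
  have p: "?p A B \<longleftrightarrow> A \<in> effects n \<and> B \<in> effects n \<and> psd n (1\<^sub>m n - (A + B))" for A B
    by (auto simp: Ef_def loewner_le_def effects_iff)
  have c: "A \<in> carrier_mat n n" if "A \<in> effects n" for A using that effects_iff by auto
  have plus: "A + B \<in> effects n" if "?p A B" for A B
    using that c by (auto simp: p effects_iff intro: psd_add)
  have sub: "A \<in> effects n" if "A + B \<in> effects n" "psd n A" "psd n B" for A B
  proof -
    have cc: "A \<in> carrier_mat n n" "B \<in> carrier_mat n n" using that psd_def by auto
    then have "1\<^sub>m n - A = (1\<^sub>m n - (A + B)) + B" by (intro eq_matI) auto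
    then show ?thesis using that cc by (auto simp: effects_iff intro: psd_add)
  qed
  have one: "1\<^sub>m n - 0\<^sub>m n n = (1\<^sub>m n :: complex mat)" by auto
  have rot: "1\<^sub>m n - (1\<^sub>m n - A) = A" if "A \<in> carrier_mat n n" for A :: "complex mat"
    using that by (intro eq_matI) auto
  show ?thesis
  proof
    show "pzero (Ef n) \<in> elems (Ef n)"
      by (auto simp: Ef_def effects_iff psd_zero one psd_one)
  next
    fix A B assume "perp (Ef n) A B"
    then show "A \<in> elems (Ef n) \<and> B \<in> elems (Ef n)" by (auto simp: Ef_def)
  next
    fix A B assume "perp (Ef n) A B"
    then show "padd (Ef n) A B \<in> elems (Ef n)" using plus by (auto simp: Ef_def)
  next
    fix A B assume h: "perp (Ef n) A B"
    then have "B + A = A + B" using c p by (metis comm_add_mat)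
    then show "perp (Ef n) B A \<and> padd (Ef n) B A = padd (Ef n) A B"
      using h p by (auto simp: Ef_def)
  next
    fix A B C assume h: "perp (Ef n) A B" "perp (Ef n) (padd (Ef n) A B) C"
    have h2: "?p (A + B) C" using h(2) by (simp add: Ef_def)
    have m: "A \<in> effects n" "B \<in> effects n" "C \<in> effects n" using h h2 p by auto
    have a: "A + (B + C) = (A + B) + C" using m c by (metis assoc_add_mat)
    have e: "(B + C) + A \<in> effects n" using plus[OF h2] a m c by (metis comm_add_mat add_carrier_mat)
    have bc: "B + C \<in> effects n"
      by (rule sub[OF e]) (use m effects_iff psd_add in auto)
    then show "perp (Ef n) B C \<and> perp (Ef n) A (padd (Ef n) B C) \<and>
        padd (Ef n) A (padd (Ef n) B C) = padd (Ef n) (padd (Ef n) A B) C"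
      using m a h2 p by (auto simp: Ef_def effects_iff loewner_le_def)
  next
    fix A assume "A \<in> elems (Ef n)"
    then show "perp (Ef n) (pzero (Ef n)) A \<and> padd (Ef n) (pzero (Ef n)) A = A"
      by (auto simp: Ef_def effects_iff loewner_le_def psd_zero one psd_one)
  next
    fix A assume "A \<in> elems (Ef n)"
    then show "ortho (Ef n) A \<in> elems (Ef n)"
      by (auto simp: Ef_def effects_iff rot)
  next
    fix A B assume h: "A \<in> elems (Ef n)" "B \<in> elems (Ef n)"
    then have cc: "A \<in> carrier_mat n n" "B \<in> carrier_mat n n" by (auto simp: Ef_def effects_iff)
    have "A + B = 1\<^sub>m n \<longleftrightarrow> B = 1\<^sub>m n - A"
    proof
      assume "A + B = 1\<^sub>m n"
      then have "1\<^sub>m n - A = A + B - A" by simp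
      also have "\<dots> = B" using cc by (intro eq_matI) auto
      finally show "B = 1\<^sub>m n - A" by simp
    qed (use cc in \<open>auto intro!: eq_matI\<close>)
    moreover have "psd n (1\<^sub>m n - (A + B))" if "A + B = 1\<^sub>m n"
    proof -
      have e: "1\<^sub>m n - 1\<^sub>m n = (0\<^sub>m n n :: complex mat)" by (intro eq_matI) auto
      show ?thesis unfolding that e by (rule psd_zero)
    qed
    ultimately show "perp (Ef n) A B \<and> padd (Ef n) A B = ortho (Ef n) (pzero (Ef n)) \<longleftrightarrow> B = ortho (Ef n) A"
      using h p one by (auto simp: Ef_def)
  next
    fix A assume "perp (Ef n) A (ortho (Ef n) (pzero (Ef n)))"
    then have "psd n (1\<^sub>m n - (A + 1\<^sub>m n))" "A \<in> effects n"
      using p one by (auto simp: Ef_def)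
    moreover have "1\<^sub>m n - (A + 1\<^sub>m n) = - A" using c[OF \<open>A \<in> effects n\<close>] by (intro eq_matI) auto
    ultimately have "A = 0\<^sub>m n n"
      by (intro psd_antisym) (simp_all add: effects_iff)
    then show "A = pzero (Ef n)" by (simp add: Ef_def)
  qed
qed

definition density :: "nat \<Rightarrow> complex mat set" where
  "density n = {A. psd n A \<and> (\<Sum>i<n. A $$ (i, i)) = 1}"


section \<open>Composite quantum systems\<close>

text \<open>Each system \<open>S\<close> has the Hilbert space \<open>\<complex>\<^bsup>dims S\<^esup>\<close>. The linear order on systems is the
  order of the Kronecker factors.\<close>

definition hdim :: "('s \<Rightarrow> nat) \<Rightarrow> 's set \<Rightarrow> nat" where
  "hdim dims C = (\<Prod>S\<in>C. dims S)"

text \<open>The position, in the Kronecker product of the spaces of \<open>C\<close> in increasing order, of the tensor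
  product of the standard basis vectors with index \<open>f S\<close> in the space of \<open>S\<close>.\<close>

definition basis_index :: "('s::linorder \<Rightarrow> nat) \<Rightarrow> 's set \<Rightarrow> ('s \<Rightarrow> nat) \<Rightarrow> nat" where
  "basis_index dims C f = foldl (\<lambda>a S. a * dims S + f S) 0 (sorted_list_of_set C)"

definition kron :: "complex mat \<Rightarrow> complex mat \<Rightarrow> complex mat" where
  "kron A B = mat (dim_row A * dim_row B) (dim_col A * dim_col B)
     (\<lambda>(i, j). A $$ (i div dim_row B, j div dim_col B) * B $$ (i mod dim_row B, j mod dim_col B))"

text \<open>The permutation unitary from \<open>H\<^sub>A \<otimes> H\<^sub>B\<close> to the space of \<open>A \<union> B\<close>, for disjoint \<open>A\<close> and \<open>B\<close>.\<close>

definition sort_mat :: "('s::linorder \<Rightarrow> nat) \<Rightarrow> 's set \<Rightarrow> 's set \<Rightarrow> complex mat" where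
  "sort_mat dims A B = mat (hdim dims (A \<union> B)) (hdim dims A * hdim dims B)
     (\<lambda>(i, j). if \<exists>f. (\<forall>S\<in>A \<union> B. f S < dims S) \<and> i = basis_index dims (A \<union> B) f \<and>
                     j = basis_index dims A f * hdim dims B + basis_index dims B f
               then 1 else 0)"

definition boxtimes ::
  "('s::linorder \<Rightarrow> nat) \<Rightarrow> 's set \<Rightarrow> 's set \<Rightarrow> complex mat \<Rightarrow> complex mat \<Rightarrow> complex mat" where
  "boxtimes dims A B L1 L2 = sort_mat dims A B * kron L1 L2 * mat_adjoint (sort_mat dims A B)"

text \<open>The partial trace over \<open>H\<^sub>A\<close> of a matrix on the space of \<open>A \<union> B\<close>: move it back to \<open>H\<^sub>A \<otimes> H\<^sub>B\<close>
  and trace out the first factor.\<close>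

definition partial_trace ::
  "('s::linorder \<Rightarrow> nat) \<Rightarrow> 's set \<Rightarrow> 's set \<Rightarrow> complex mat \<Rightarrow> complex mat" where
  "partial_trace dims A B M =
     (let N = mat_adjoint (sort_mat dims A B) * M * sort_mat dims A B; b = hdim dims B in
      mat b b (\<lambda>(i, j). \<Sum>k<hdim dims A. N $$ (k * b + i, k * b + j)))"

definition partial_eval ::
  "('s::linorder \<Rightarrow> nat) \<Rightarrow> 's set \<Rightarrow> 's set \<Rightarrow> complex mat \<Rightarrow> complex mat \<Rightarrow> complex mat" where
  "partial_eval dims C C' \<rho> L =
     partial_trace dims C' (C - C') (L * boxtimes dims C' (C - C') \<rho> (1\<^sub>m (hdim dims (C - C'))))"

text \<open>\<open>qlts_functor dims C L\<close> is \<open>\<P>(Q\<^sub>C-)\<^sup>L\<close>.\<close>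

definition qlts_functor ::
  "('s \<Rightarrow> nat) \<Rightarrow> 's set \<Rightarrow> 'l set \<Rightarrow> ('u, 'l \<Rightarrow> ('u \<Rightarrow> complex mat) set) set_functor" where
  "qlts_functor dims C L = lts_functor L (dist_functor (Ef (hdim dims C)))"

definition qlts_partial_eval ::
  "('s::linorder \<Rightarrow> nat) \<Rightarrow> 's set \<Rightarrow> 's set \<Rightarrow> complex mat \<Rightarrow> 'l set \<Rightarrow>
   'u set \<times> ('u \<Rightarrow> 'l \<Rightarrow> ('u \<Rightarrow> complex mat) set) \<Rightarrow>
   'u set \<times> ('u \<Rightarrow> 'l \<Rightarrow> ('u \<Rightarrow> complex mat) set)" where
  "qlts_partial_eval dims C C' \<rho> L = (\<lambda>(X, c).
     (X, \<lambda>x\<in>X. \<lambda>\<mu>\<in>L. {compose X (partial_eval dims C C' \<rho>) \<Delta> | \<Delta>. \<Delta> \<in> c x \<mu>}))"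


section \<open>Extensible graded monads\<close>

record ('m, 'u) graded_monad =
  grades :: "'m pcm"
  gfunc :: "'m \<Rightarrow> ('u, 'u) set_functor"
  gunit :: "'u set \<Rightarrow> 'u \<Rightarrow> 'u"
  gmult :: "'m \<Rightarrow> 'm \<Rightarrow> 'u set \<Rightarrow> 'u \<Rightarrow> 'u"
  gext :: "'m \<Rightarrow> 'm \<Rightarrow> 'u set \<Rightarrow> 'u \<Rightarrow> 'u"

abbreviation tobj :: "('m, 'u) graded_monad \<Rightarrow> 'm \<Rightarrow> 'u set \<Rightarrow> 'u set" where
  "tobj T m \<equiv> obj (gfunc T m)"

abbreviation tmor ::
  "('m, 'u) graded_monad \<Rightarrow> 'm \<Rightarrow> 'u set \<Rightarrow> 'u set \<Rightarrow> ('u \<Rightarrow> 'u) \<Rightarrow> 'u \<Rightarrow> 'u" where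
  "tmor T m \<equiv> mor (gfunc T m)"

locale extensible_graded_monad =
  fixes U :: "'u set set" and T :: "('m, 'u) graded_monad"
  assumes pcm: "pcm (grades T)"
    and grade_functor: "m \<in> elems (grades T) \<Longrightarrow> endofunctor U (gfunc T m)"
    and unit_type: "X \<in> U \<Longrightarrow> gunit T X \<in> X \<rightarrow>\<^sub>E tobj T (pzero (grades T)) X"
    and unit_natural: "\<lbrakk>X \<in> U; Y \<in> U; f \<in> X \<rightarrow>\<^sub>E Y; x \<in> X\<rbrakk> \<Longrightarrow>
      tmor T (pzero (grades T)) X Y f (gunit T X x) = gunit T Y (f x)"
    and mult_type: "\<lbrakk>perp (grades T) m n; X \<in> U\<rbrakk> \<Longrightarrow>
      gmult T m n X \<in> tobj T m (tobj T n X) \<rightarrow>\<^sub>E tobj T (padd (grades T) m n) X"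
    and mult_natural: "\<lbrakk>perp (grades T) m n; X \<in> U; Y \<in> U; f \<in> X \<rightarrow>\<^sub>E Y;
        z \<in> tobj T m (tobj T n X)\<rbrakk> \<Longrightarrow>
      tmor T (padd (grades T) m n) X Y f (gmult T m n X z) =
      gmult T m n Y (tmor T m (tobj T n X) (tobj T n Y) (tmor T n X Y f) z)"
    and mult_assoc: "\<lbrakk>perp (grades T) m n; perp (grades T) (padd (grades T) m n) k; X \<in> U;
        z \<in> tobj T m (tobj T n (tobj T k X))\<rbrakk> \<Longrightarrow>
      gmult T (padd (grades T) m n) k X (gmult T m n (tobj T k X) z) =
      gmult T m (padd (grades T) n k) X
        (tmor T m (tobj T n (tobj T k X)) (tobj T (padd (grades T) n k) X) (gmult T n k X) z)"
    and unit_left: "\<lbrakk>m \<in> elems (grades T); X \<in> U; z \<in> tobj T m X\<rbrakk> \<Longrightarrow>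
      gmult T (pzero (grades T)) m X (gunit T (tobj T m X) z) = z"
    and unit_right: "\<lbrakk>m \<in> elems (grades T); X \<in> U; z \<in> tobj T m X\<rbrakk> \<Longrightarrow>
      gmult T m (pzero (grades T)) X (tmor T m X (tobj T (pzero (grades T)) X) (gunit T X) z) = z"
    and ext_type: "\<lbrakk>preceq (grades T) m n; X \<in> U\<rbrakk> \<Longrightarrow> gext T m n X \<in> tobj T m X \<rightarrow>\<^sub>E tobj T n X"
    and ext_natural: "\<lbrakk>preceq (grades T) m n; X \<in> U; Y \<in> U; f \<in> X \<rightarrow>\<^sub>E Y; z \<in> tobj T m X\<rbrakk> \<Longrightarrow>
      tmor T n X Y f (gext T m n X z) = gext T m n Y (tmor T m X Y f z)"
    and ext_refl: "\<lbrakk>m \<in> elems (grades T); X \<in> U; z \<in> tobj T m X\<rbrakk> \<Longrightarrow> gext T m m X z = z"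
    and ext_trans: "\<lbrakk>preceq (grades T) m n; preceq (grades T) n k; X \<in> U; z \<in> tobj T m X\<rbrakk> \<Longrightarrow>
      gext T n k X (gext T m n X z) = gext T m k X z"

definition natural_pairing ::
  "'u set set \<Rightarrow> ('u \<times> 'u \<Rightarrow> 'u) \<Rightarrow> ('m, 'u) graded_monad \<Rightarrow> 'm \<Rightarrow> 'm \<Rightarrow>
   ('u set \<Rightarrow> 'u set \<Rightarrow> 'u \<Rightarrow> 'u) \<Rightarrow> bool" where
  "natural_pairing U pr T m n \<alpha> \<longleftrightarrow>
     (\<forall>X\<in>U. \<forall>Y\<in>U. \<alpha> X Y \<in> cprod pr (tobj T m X) (tobj T n Y) \<rightarrow>\<^sub>E
        tobj T (padd (grades T) m n) (cprod pr X Y)) \<and>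
     (\<forall>X\<in>U. \<forall>X'\<in>U. \<forall>Y\<in>U. \<forall>Y'\<in>U. \<forall>f\<in>X \<rightarrow>\<^sub>E X'. \<forall>g\<in>Y \<rightarrow>\<^sub>E Y'.
        \<forall>z\<in>cprod pr (tobj T m X) (tobj T n Y).
        tmor T (padd (grades T) m n) (cprod pr X Y) (cprod pr X' Y') (cprod_map pr X Y f g) (\<alpha> X Y z) =
        \<alpha> X' Y' (cprod_map pr (tobj T m X) (tobj T n Y) (tmor T m X X' f) (tmor T n Y Y' g) z))"


section \<open>Synchronization and parallel composition\<close>

text \<open>\<open>gpoint T m X x\<close> is \<open>\<xi>\<^bsub>0\<preceq>m\<^esub>(\<eta>(x))\<close>.\<close>

definition gpoint :: "('m, 'u) graded_monad \<Rightarrow> 'm \<Rightarrow> 'u set \<Rightarrow> 'u \<Rightarrow> 'u" where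
  "gpoint T m X x = gext T (pzero (grades T)) m X (gunit T X x)"

locale sync_labels =
  fixes L :: "'l set" and \<tau> :: 'l and bar :: "'l \<Rightarrow> 'l"
  assumes tau_in: "\<tau> \<in> L"
    and bar_in: "\<mu> \<in> L - {\<tau>} \<Longrightarrow> bar \<mu> \<in> L - {\<tau>}"
    and bar_bar: "\<mu> \<in> L - {\<tau>} \<Longrightarrow> bar (bar \<mu>) = \<mu>"

inductive sync_step ::
  "('u \<times> 'u \<Rightarrow> 'u) \<Rightarrow> ('m, 'u) graded_monad \<Rightarrow> 'm \<Rightarrow> 'm \<Rightarrow> 'l set \<Rightarrow> 'l \<Rightarrow> ('l \<Rightarrow> 'l) \<Rightarrow>
   'u set \<times> ('u \<Rightarrow> 'l \<Rightarrow> 'u set) \<Rightarrow> 'u set \<times> ('u \<Rightarrow> 'l \<Rightarrow> 'u set) \<Rightarrow> 'u \<Rightarrow> 'l \<Rightarrow> 'u \<Rightarrow> bool"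
  for pr T m n L \<tau> bar A B where
  left: "\<lbrakk>s \<in> fst A; t \<in> fst B; \<mu> \<in> L; \<Delta> \<in> snd A s \<mu>\<rbrakk> \<Longrightarrow>
    sync_step pr T m n L \<tau> bar A B (pr (s, t)) \<mu> (pr (\<Delta>, gpoint T n (fst B) t))"
| right: "\<lbrakk>s \<in> fst A; t \<in> fst B; \<mu> \<in> L; \<Theta> \<in> snd B t \<mu>\<rbrakk> \<Longrightarrow>
    sync_step pr T m n L \<tau> bar A B (pr (s, t)) \<mu> (pr (gpoint T m (fst A) s, \<Theta>))"
| both: "\<lbrakk>s \<in> fst A; t \<in> fst B; \<mu> \<in> L - {\<tau>}; \<Delta> \<in> snd A s \<mu>; \<Theta> \<in> snd B t (bar \<mu>)\<rbrakk> \<Longrightarrow>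
    sync_step pr T m n L \<tau> bar A B (pr (s, t)) \<tau> (pr (\<Delta>, \<Theta>))"

definition sync ::
  "('u \<times> 'u \<Rightarrow> 'u) \<Rightarrow> ('m, 'u) graded_monad \<Rightarrow> 'm \<Rightarrow> 'm \<Rightarrow> 'l set \<Rightarrow> 'l \<Rightarrow> ('l \<Rightarrow> 'l) \<Rightarrow>
   'u set \<times> ('u \<Rightarrow> 'l \<Rightarrow> 'u set) \<Rightarrow> 'u set \<times> ('u \<Rightarrow> 'l \<Rightarrow> 'u set) \<Rightarrow> 'u \<Rightarrow> 'l \<Rightarrow> 'u set" where
  "sync pr T m n L \<tau> bar A B =
     (\<lambda>p\<in>cprod pr (fst A) (fst B). \<lambda>\<mu>\<in>L. {\<Delta>. sync_step pr T m n L \<tau> bar A B p \<mu> \<Delta>})"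

text \<open>Since \<open>\<P>\<close> is the \<^emph>\<open>finite\<close> powerset, the least transition function closed under the rules has the
  type \<open>X \<times> Y \<rightarrow> \<P>(T\<^sub>m X \<times> T\<^sub>n Y)\<^sup>L\<close> only if each state has finitely many \<open>\<tau>\<close>-successors. This
  is automatic for finite \<open>L\<close> (shown below), but can fail for infinite \<open>L\<close>, as the third rule ranges over all labels.\<close>

definition sync_defined ::
  "('u \<times> 'u \<Rightarrow> 'u) \<Rightarrow> ('m, 'u) graded_monad \<Rightarrow> 'm \<Rightarrow> 'm \<Rightarrow> 'l set \<Rightarrow> 'l \<Rightarrow> ('l \<Rightarrow> 'l) \<Rightarrow>
   'u set \<times> ('u \<Rightarrow> 'l \<Rightarrow> 'u set) \<Rightarrow> 'u set \<times> ('u \<Rightarrow> 'l \<Rightarrow> 'u set) \<Rightarrow> bool" where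
  "sync_defined pr T m n L \<tau> bar A B \<longleftrightarrow>
     sync pr T m n L \<tau> bar A B \<in> cprod pr (fst A) (fst B) \<rightarrow>\<^sub>E
       (L \<rightarrow>\<^sub>E Fpow (cprod pr (tobj T m (fst A)) (tobj T n (fst B))))"

lemma sync_defined_finite_labels:
  assumes T: "extensible_graded_monad U T" "perp (grades T) m n"
    and A: "coalgebra U (lts_functor L (gfunc T m)) A"
    and B: "coalgebra U (lts_functor L (gfunc T n)) B"
    and pr: "inj pr" and L: "finite L" "sync_labels L \<tau> bar"
  shows "sync_defined pr T m n L \<tau> bar A B"
proof -
  interpret extensible_graded_monad U T by fact
  interpret pcm "grades T" by (rule pcm)
  interpret sync_labels L \<tau> bar by fact
  obtain X c Y d where AB: "A = (X, c)" "B = (Y, d)" by (cases A, cases B)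
  have U: "X \<in> U" "Y \<in> U" using A B by (auto simp: AB coalgebra_def)
  have c: "finite (c s \<mu>)" "c s \<mu> \<subseteq> tobj T m X" if "s \<in> X" "\<mu> \<in> L" for s \<mu>
    using A that by (auto simp: AB coalgebra_def lts_functor_def Fpow_def PiE_iff)
  have d: "finite (d t \<mu>)" "d t \<mu> \<subseteq> tobj T n Y" if "t \<in> Y" "\<mu> \<in> L" for t \<mu>
    using B that by (auto simp: AB coalgebra_def lts_functor_def Fpow_def PiE_iff)
  have pq: "preceq (grades T) (pzero (grades T)) k" if "k \<in> elems (grades T)" for k
    using that zero_add by (auto simp: preceq_def)
  have mn: "m \<in> elems (grades T)" "n \<in> elems (grades T)" using perp_elems T(2) by auto
  have g: "gpoint T m X s \<in> tobj T m X" if "s \<in> X" for s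
    using ext_type[OF pq[OF mn(1)] U(1)] unit_type[OF U(1)] that by (auto simp: gpoint_def)
  have g': "gpoint T n Y t \<in> tobj T n Y" if "t \<in> Y" for t
    using ext_type[OF pq[OF mn(2)] U(2)] unit_type[OF U(2)] that by (auto simp: gpoint_def)
  have "{\<Delta>. sync_step pr T m n L \<tau> bar A B (pr (s, t)) \<mu> \<Delta>} \<in> Fpow (cprod pr (tobj T m X) (tobj T n Y))"
    if st: "s \<in> X" "t \<in> Y" "\<mu> \<in> L" for s t \<mu>
  proof -
    let ?F = "(c s \<mu> \<times> {gpoint T n Y t}) \<union> ({gpoint T m X s} \<times> d t \<mu>) \<union>
        (\<Union>\<nu>\<in>L - {\<tau>}. c s \<nu> \<times> d t (bar \<nu>))"
    have "{\<Delta>. sync_step pr T m n L \<tau> bar A B (pr (s, t)) \<mu> \<Delta>} \<subseteq> pr ` ?F"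
      using pr by (auto simp: AB inj_eq elim!: sync_step.cases)
    moreover have "finite ?F" using L(1) c d st bar_in by auto
    moreover have "?F \<subseteq> tobj T m X \<times> tobj T n Y"
    proof (intro Un_least UN_least Sigma_mono)
      fix \<nu> assume \<nu>: "\<nu> \<in> L - {\<tau>}"
      show "c s \<nu> \<subseteq> tobj T m X" using c(2) st \<nu> by blast
      show "d t (bar \<nu>) \<subseteq> tobj T n Y" using d(2) st bar_in[OF \<nu>] by blast
    qed (use c(2) d(2) g g' st in auto)
    ultimately show ?thesis unfolding Fpow_def cprod_def
      by (blast intro: finite_subset image_mono)
  qed
  then show ?thesis
    by (auto simp: sync_defined_def sync_def AB cprod_def)
qed

definition par ::
  "('u \<times> 'u \<Rightarrow> 'u) \<Rightarrow> ('m, 'u) graded_monad \<Rightarrow> 'm \<Rightarrow> 'm \<Rightarrow> ('u set \<Rightarrow> 'u set \<Rightarrow> 'u \<Rightarrow> 'u) \<Rightarrow>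
   'l set \<Rightarrow> 'l \<Rightarrow> ('l \<Rightarrow> 'l) \<Rightarrow>
   'u set \<times> ('u \<Rightarrow> 'l \<Rightarrow> 'u set) \<Rightarrow> 'u set \<times> ('u \<Rightarrow> 'l \<Rightarrow> 'u set) \<Rightarrow>
   'u set \<times> ('u \<Rightarrow> 'l \<Rightarrow> 'u set)" where
  "par pr T m n \<alpha> L \<tau> bar A B =
     (cprod pr (fst A) (fst B),
      compose (cprod pr (fst A) (fst B)) (lts_map L (\<alpha> (fst A) (fst B))) (sync pr T m n L \<tau> bar A B))"

end

theory Submission
  imports Defs
begin

text \<open>Both parts transport the cospan that witnesses bisimilarity. For (a), \<open>p\<^sub>\<rho>\<close> is linear, positive
  and unital, hence a homomorphism of effect algebras; post-composition with it is therefore a natural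
  transformation between the distribution functors, and such a transformation turns homomorphisms of
  coalgebras into homomorphisms. In the standard basis \<open>p\<^sub>\<rho>(L)\<close> has the entries
  \<open>\<Sum>\<^sub>k\<^sub>l L((k, i), (l, j)) \<rho>(l, k)\<close>, and positivity follows by writing \<open>\<rho>\<close> as a sum of rank-one matrices.
  For (b), the product of two homomorphisms is a homomorphism between the parallel compositions, by
  naturality of \<open>\<alpha>\<close>, \<open>\<xi>\<close> and \<open>\<eta>\<close>.\<close>

section \<open>Partial sums\<close>

text \<open>For (a), the weights of a pushed-forward distribution are partial sums fixed by a
  definite description. Naturality therefore needs these sums to exist over fibres and not to depend
  on the order of summation. A homomorphism may also annihilate nonzero weights, so supports can
  shrink under post-composition. Positivity of the partial evaluation is not inherited from its
  factors: L times (rho tensor identity) is a product of positive matrices and need not even be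
  Hermitian. Rank-one vectors w_r of rho give instead the identity <v, p(L) v> = sum over r of <w_r
  tensor v, L (w_r tensor v)>. Trace one makes p unital, and unitality keeps the upper bound I of
  effects. For (b), the obstacle is the finite powerset: synchronizing the apexes of two cospans may
  produce infinite branching, so the common target of the product homomorphisms is a truncated
  composition.\<close>

context pcm
begin

lemma psum_elems: "psum M \<Delta> S a \<Longrightarrow> a \<in> elems M"
  by (induction rule: psum.induct) (auto simp: zero_elem add_elem)

text \<open>Reassociate, rotate by commutativity and reassociate again; definedness travels along at
  each stage. This exchange of the last two summands is what makes \<open>psum\<close> independent
  of the order of insertion.\<close>

lemma swap_right:
  assumes "perp M a b" "perp M (padd M a b) c"
  shows "perp M a c" "perp M (padd M a c) b" "padd M (padd M a c) b = padd M (padd M a b) c"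
proof -
  have 1: "perp M b c" "perp M a (padd M b c)" "padd M a (padd M b c) = padd M (padd M a b) c"
    using assoc[OF assms] by auto
  have 2: "perp M (padd M b c) a" "padd M (padd M b c) a = padd M (padd M a b) c"
    using comm[OF 1(2)] 1(3) by auto
  have 3: "perp M c a" "perp M b (padd M c a)" "padd M b (padd M c a) = padd M (padd M a b) c"
    using assoc[OF 1(1) 2(1)] 2(2) by auto
  show "perp M a c" "perp M (padd M a c) b" "padd M (padd M a c) b = padd M (padd M a b) c"
    using comm[OF 3(1)] comm[OF 3(2)] 3(3) by auto
qed

text \<open>The rules of \<open>psum\<close> expose only the summand inserted last. Here any summand
  can be regarded as the last one, by moving it past the later ones with
  \<open>swap_right\<close>.\<close>

lemma psum_remove:
  assumes "psum M \<Delta> S a" "x \<in> S"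
  shows "\<exists>b. psum M \<Delta> (S - {x}) b \<and> perp M b (\<Delta> x) \<and> a = padd M b (\<Delta> x)"
  using assms
proof (induction rule: psum.induct)
  case (2 S a y)
  show ?case
  proof (cases "x = y")
    case True
    with 2 show ?thesis by auto
  next
    case False
    with 2 obtain b where b: "psum M \<Delta> (S - {x}) b" "perp M b (\<Delta> x)" "a = padd M b (\<Delta> x)"
      by auto
    note sw = swap_right[OF b(2) 2(3)[unfolded b(3)]]
    have "psum M \<Delta> (insert y (S - {x})) (padd M b (\<Delta> y))"
      using b(1) 2(2) sw(1) by (intro psum.intros) auto
    moreover have "insert y (S - {x}) = insert y S - {x}" using False by auto
    ultimately show ?thesis using sw b(3) by metis
  qed
qed simp

lemma psum_unique:
  assumes "psum M \<Delta> S a" "psum M \<Delta> S b"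
  shows "a = b"
  using assms
proof (induction arbitrary: b rule: psum.induct)
  case 1
  then show ?case by (cases rule: psum.cases) auto
next
  case (2 S a x)
  \<comment> \<open>The derivation for \<open>b\<close> may have inserted \<open>x\<close> at any
    stage; removal brings \<open>x\<close> to the end, where the two derivations can be
    compared.\<close>
  from psum_remove[OF 2(5), of x] 2(2)
  obtain b' where "psum M \<Delta> S b'" "b = padd M b' (\<Delta> x)" by auto
  with 2(4) show ?case by auto
qed

lemma psum_val_eq: "psum M \<Delta> S a \<Longrightarrow> psum_val M \<Delta> S = a"
  unfolding psum_val_def using psum_unique by blast

lemma psum_diff:
  assumes "finite D" "psum M \<Delta> S a"
  shows "\<exists>b. psum M \<Delta> (S - D) b"
  using assms(1)
proof induction
  case (insert x D)
  then obtain b where b: "psum M \<Delta> (S - D) b" by auto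
  have "S - insert x D = S - D - {x}" by auto
  then show ?case using psum_remove[OF b, of x] b by (cases "x \<in> S - D") auto
qed (use assms in auto)

lemma psum_finite: "psum M \<Delta> S a \<Longrightarrow> finite S"
  by (induction rule: psum.induct) auto

text \<open>Guarantees that the fibre sums in \<open>dist_functor\<close> exist, so that the
  description in \<open>psum_val\<close> denotes a genuine sum. The complement of \<open>R\<close>
  is deleted one summand at a time.\<close>

lemma psum_subset:
  assumes "psum M \<Delta> S a" "R \<subseteq> S"
  shows "\<exists>b. psum M \<Delta> R b"
  using psum_diff[OF _ assms(1), of "S - R"] psum_finite[OF assms(1)] assms(2)
  by (simp add: double_diff)

text \<open>Reconciles a sum over the support of a distribution with the sum over the possibly
  smaller support of its image under a homomorphism.\<close>

lemma psum_nonzero: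
  "psum M \<Delta> S a \<Longrightarrow> psum M \<Delta> {x \<in> S. \<Delta> x \<noteq> pzero M} a"
proof (induction rule: psum.induct)
  case 1
  then show ?case by (simp add: psum.intros)
next
  case (2 S a x)
  show ?case
  proof (cases "\<Delta> x = pzero M")
    case True
    have "padd M a (pzero M) = a"
      using zero_add[OF psum_elems[OF 2(1)]] comm by metis
    moreover have "{z \<in> insert x S. \<Delta> z \<noteq> pzero M} = {z \<in> S. \<Delta> z \<noteq> pzero M}"
      using True by auto
    ultimately show ?thesis using 2(4) True by auto
  next
    case False
    then have "{z \<in> insert x S. \<Delta> z \<noteq> pzero M} = insert x {z \<in> S. \<Delta> z \<noteq> pzero M}"
      by auto
    then show ?thesis using 2 by (auto intro: psum.intros)
  qed
qed

end

section \<open>Homomorphisms of partial commutative monoids and their action on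
  distributions\<close>

lemma psum_cong:
  assumes "psum E \<Delta> S a" "\<And>x. x \<in> S \<Longrightarrow> \<Delta>' x = \<Delta> x"
  shows "psum E \<Delta>' S a"
  using assms
proof (induction rule: psum.induct)
  case (2 S a x)
  then have "psum E \<Delta>' (insert x S) (padd E a (\<Delta>' x))" by (intro psum.intros) auto
  then show ?case using 2 by simp
qed (rule psum.intros)

locale pcm_hom = E: pcm E + E': pcm E'
  for E :: "('a, 'c) pcm_scheme" and E' :: "('b, 'd) pcm_scheme" +
  fixes h :: "'a \<Rightarrow> 'b"
  assumes hom_zero: "h (pzero E) = pzero E'"
    and hom_add: "perp E a b \<Longrightarrow> perp E' (h a) (h b) \<and> h (padd E a b) = padd E' (h a) (h b)"
    and hom_elem: "a \<in> elems E \<Longrightarrow> h a \<in> elems E'"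
begin

lemma psum_hom: "psum E \<Delta> S a \<Longrightarrow> psum E' (h \<circ> \<Delta>) S (h a)"
proof (induction rule: psum.induct)
  case (2 S a x)
  then have "psum E' (h \<circ> \<Delta>) (insert x S) (padd E' (h a) ((h \<circ> \<Delta>) x))"
    using hom_add[OF 2(3)] by (intro psum.intros) (auto simp: o_def)
  with hom_add[OF 2(3)] show ?case by (simp add: o_def)
qed (simp add: hom_zero psum.intros)

lemma psum_compose:
  assumes "psum E \<Delta> S a" "S \<subseteq> X"
  shows "psum E' (compose X h \<Delta>) {x \<in> S. h (\<Delta> x) \<noteq> pzero E'} (h a)"
proof -
  have "psum E' (h \<circ> \<Delta>) {x \<in> S. h (\<Delta> x) \<noteq> pzero E'} (h a)"
    using E'.psum_nonzero[OF psum_hom[OF assms(1)]] by simp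
  then show ?thesis by (rule psum_cong) (use assms(2) in \<open>auto simp: compose_def\<close>)
qed

lemma supp_compose:
  "supp E' X (compose X h \<Delta>) = {x \<in> supp E X \<Delta>. h (\<Delta> x) \<noteq> pzero E'}"
  by (auto simp: supp_def compose_def hom_zero)

lemma dist_compose:
  assumes "\<Delta> \<in> dist E X"
  shows "compose X h \<Delta> \<in> dist E' X"
proof -
  obtain a where "psum E \<Delta> (supp E X \<Delta>) a" using assms by (auto simp: dist_def)
  from psum_compose[OF this, of X] have "psum E' (compose X h \<Delta>) (supp E' X (compose X h \<Delta>)) (h a)"
    by (simp add: supp_compose) (auto simp: supp_def)
  moreover have "finite (supp E' X (compose X h \<Delta>))"
    using assms by (auto simp: supp_compose dist_def)
  moreover have "compose X h \<Delta> \<in> X \<rightarrow>\<^sub>E elems E'"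
    using assms hom_elem by (auto simp: dist_def compose_def)
  ultimately show ?thesis by (auto simp: dist_def)
qed

text \<open>This is the naturality square. The fibre sum in \<open>E\<close> exists because it is
  part of a defined sum; \<open>h\<close> carries it to a sum in \<open>E'\<close> over the
  surviving support, and uniqueness of sums identifies that with the description on the
  left.\<close>

lemma dist_functor_compose:
  assumes \<Delta>: "\<Delta> \<in> dist E X"
  shows "mor (dist_functor E') X Y f (compose X h \<Delta>) = compose Y h (mor (dist_functor E) X Y f \<Delta>)"
proof -
  obtain a where a: "psum E \<Delta> (supp E X \<Delta>) a" using \<Delta> by (auto simp: dist_def)
  have "psum_val E' (compose X h \<Delta>) {x \<in> supp E' X (compose X h \<Delta>). f x = y} =
      h (psum_val E \<Delta> {x \<in> supp E X \<Delta>. f x = y})" for y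
  proof -
    obtain b where b: "psum E \<Delta> {x \<in> supp E X \<Delta>. f x = y} b"
      using E.psum_subset[OF a, of "{x \<in> supp E X \<Delta>. f x = y}"] by auto
    have eq: "{x \<in> supp E' X (compose X h \<Delta>). f x = y} =
        {x \<in> {x \<in> supp E X \<Delta>. f x = y}. h (\<Delta> x) \<noteq> pzero E'}"
      by (auto simp: supp_compose)
    have "psum E' (compose X h \<Delta>) {x \<in> supp E' X (compose X h \<Delta>). f x = y} (h b)"
      unfolding eq by (rule psum_compose[OF b]) (auto simp: supp_def)
    then show ?thesis using E'.psum_val_eq E.psum_val_eq[OF b] by simp
  qed
  then show ?thesis
    using \<Delta> dist_compose[OF \<Delta>] by (auto simp: dist_functor_def compose_def)
qed

end


section \<open>Natural transformations preserve kernel bisimilarity\<close>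

text \<open>Partial evaluation of a qLTS is the instance in which \<open>\<theta> X\<close> is
  post-composition with the partial evaluation map.\<close>

definition lts_transform ::
  "'l set \<Rightarrow> ('u set \<Rightarrow> 'v \<Rightarrow> 'w) \<Rightarrow> 'u set \<times> ('u \<Rightarrow> 'l \<Rightarrow> 'v set) \<Rightarrow> 'u set \<times> ('u \<Rightarrow> 'l \<Rightarrow> 'w set)" where
  "lts_transform L \<theta> = (\<lambda>(X, c). (X, \<lambda>x\<in>X. lts_map L (\<theta> X) (c x)))"

lemma coalgebra_hom_lts_transform:
  assumes type: "\<And>X z. X \<in> U \<Longrightarrow> z \<in> obj F X \<Longrightarrow> \<theta> X z \<in> obj G X"
    and natural: "\<And>X Y f z. X \<in> U \<Longrightarrow> Y \<in> U \<Longrightarrow> f \<in> X \<rightarrow>\<^sub>E Y \<Longrightarrow> z \<in> obj F X \<Longrightarrow>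
      mor G X Y f (\<theta> X z) = \<theta> Y (mor F X Y f z)"
    and hom: "coalgebra_hom U (lts_functor L F) f A B"
  shows "coalgebra_hom U (lts_functor L G) f (lts_transform L \<theta> A) (lts_transform L \<theta> B)"
proof -
  obtain X c Y d where AB: "A = (X, c)" "B = (Y, d)" by (cases A, cases B)
  have f: "f \<in> X \<rightarrow>\<^sub>E Y" and U: "X \<in> U" "Y \<in> U"
    and c: "\<And>x. x \<in> X \<Longrightarrow> c x \<in> L \<rightarrow>\<^sub>E Fpow (obj F X)"
    and d: "\<And>y. y \<in> Y \<Longrightarrow> d y \<in> L \<rightarrow>\<^sub>E Fpow (obj F Y)"
    and eq: "\<And>x. x \<in> X \<Longrightarrow> mor (lts_functor L F) X Y f (c x) = d (f x)"
  proof -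
    have h: "X \<in> U" "Y \<in> U" "f \<in> X \<rightarrow>\<^sub>E Y" "c \<in> X \<rightarrow>\<^sub>E obj (lts_functor L F) X"
      "d \<in> Y \<rightarrow>\<^sub>E obj (lts_functor L F) Y" "\<forall>x\<in>X. mor (lts_functor L F) X Y f (c x) = d (f x)"
      using hom by (simp_all add: AB coalgebra_hom_def coalgebra_def)
    have o: "obj (lts_functor L F) W = L \<rightarrow>\<^sub>E Fpow (obj F W)" for W
      by (simp add: lts_functor_def)
    show "X \<in> U" "Y \<in> U" "f \<in> X \<rightarrow>\<^sub>E Y" by (fact h)+
    show "c x \<in> L \<rightarrow>\<^sub>E Fpow (obj F X)" if "x \<in> X" for x
      using PiE_mem[OF h(4) that] unfolding o .
    show "d y \<in> L \<rightarrow>\<^sub>E Fpow (obj F Y)" if "y \<in> Y" for y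
      using PiE_mem[OF h(5) that] unfolding o .
    show "mor (lts_functor L F) X Y f (c x) = d (f x)" if "x \<in> X" for x
      using h(6) that by blast
  qed
  have T: "lts_map L (\<theta> X) \<phi> \<in> L \<rightarrow>\<^sub>E Fpow (obj G X)"
    if "\<phi> \<in> L \<rightarrow>\<^sub>E Fpow (obj F X)" "X \<in> U" for X \<phi>
  proof -
    have "\<theta> X ` \<phi> \<mu> \<in> Fpow (obj G X)" if "\<mu> \<in> L" for \<mu>
      using PiE_mem[OF \<open>\<phi> \<in> _\<close> that] type[OF \<open>X \<in> U\<close>] by (auto simp: Fpow_def)
    then show ?thesis by (auto simp: lts_map_def)
  qed
  have "mor (lts_functor L G) X Y f (lts_map L (\<theta> X) (c x)) = lts_map L (\<theta> Y) (d (f x))"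
    if x: "x \<in> X" for x
  proof -
    have "mor G X Y f ` \<theta> X ` c x \<mu> = \<theta> Y ` mor F X Y f ` c x \<mu>" if "\<mu> \<in> L" for \<mu>
    proof -
      have "c x \<mu> \<subseteq> obj F X" using c[OF x] that by (auto simp: Fpow_def PiE_iff)
      then show ?thesis unfolding image_image
        by (intro image_cong refl natural[OF U f]) auto
    qed
    then have "lts_map L (mor G X Y f) (lts_map L (\<theta> X) (c x)) = lts_map L (\<theta> Y) (lts_map L (mor F X Y f) (c x))"
      by (auto simp: lts_map_def fun_eq_iff restrict_def)
    then show ?thesis
      using T[OF c[OF x] U(1)] c[OF x] by (simp add: eq[OF x, symmetric] lts_functor_def)
  qed
  moreover have "(\<lambda>x\<in>X. lts_map L (\<theta> X) (c x)) \<in> X \<rightarrow>\<^sub>E obj (lts_functor L G) X"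
    "(\<lambda>y\<in>Y. lts_map L (\<theta> Y) (d y)) \<in> Y \<rightarrow>\<^sub>E obj (lts_functor L G) Y"
    unfolding lts_functor_def using T[OF c U(1)] T[OF d U(2)] by auto
  ultimately show ?thesis
    using f U PiE_mem[OF f] by (simp add: AB coalgebra_hom_def coalgebra_def lts_transform_def)
qed

text \<open>The legs of the cospan stay the same functions; only the transition structure on the
  apex is transformed.\<close>

lemma kernel_bisimilar_lts_transform:
  assumes "\<And>X z. X \<in> U \<Longrightarrow> z \<in> obj F X \<Longrightarrow> \<theta> X z \<in> obj G X"
    and "\<And>X Y f z. X \<in> U \<Longrightarrow> Y \<in> U \<Longrightarrow> f \<in> X \<rightarrow>\<^sub>E Y \<Longrightarrow> z \<in> obj F X \<Longrightarrow>
      mor G X Y f (\<theta> X z) = \<theta> Y (mor F X Y f z)"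
    and "kernel_bisimilar U (lts_functor L F) A B s t"
  shows "kernel_bisimilar U (lts_functor L G) (lts_transform L \<theta> A) (lts_transform L \<theta> B) s t"
proof -
  obtain Z e m1 m2 where h: "coalgebra_hom U (lts_functor L F) m1 A (Z, e)"
    "coalgebra_hom U (lts_functor L F) m2 B (Z, e)" "m1 s = m2 t" "s \<in> fst A" "t \<in> fst B"
    using assms(3) by (auto simp: kernel_bisimilar_def)
  have fst: "fst (lts_transform L \<theta> D) = fst D" for D
    by (cases D) (simp add: lts_transform_def)
  obtain e' where e': "lts_transform L \<theta> (Z, e) = (Z, e')" by (simp add: lts_transform_def)
  have "coalgebra_hom U (lts_functor L G) m1 (lts_transform L \<theta> A) (Z, e')"
    "coalgebra_hom U (lts_functor L G) m2 (lts_transform L \<theta> B) (Z, e')"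
    unfolding e'[symmetric] using h(1,2) by (auto intro!: coalgebra_hom_lts_transform assms(1,2))
  then show ?thesis unfolding kernel_bisimilar_def fst using h(3-5) by blast
qed

section \<open>Positive semidefinite matrices\<close>

text \<open>Evaluate the form at a basis vector. Forms are indexed by an arbitrary finite set, not
  by matrix positions, so that the induction behind the rank-one decomposition can delete an index
  without renumbering.\<close>

lemma psd_diagonal:
  fixes A :: "'i \<Rightarrow> 'i \<Rightarrow> complex"
  assumes "finite I" "x \<in> I"
    and "\<And>v. 0 \<le> (\<Sum>i\<in>I. \<Sum>j\<in>I. A i j * v j * cnj (v i))"
  shows "0 \<le> A x x"
proof -
  define v where "v j = (if j = x then 1 else 0 :: complex)" for j
  have "(\<Sum>i\<in>I. \<Sum>j\<in>I. A i j * v j * cnj (v i)) =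
      (\<Sum>i\<in>I. if i = x then \<Sum>j\<in>I. if j = x then A i j else 0 else 0)"
  proof (rule sum.cong[OF refl])
    fix i
    have "(\<Sum>j\<in>I. A i j * v j) = (\<Sum>j\<in>I. if j = x then A i j else 0)"
      by (rule sum.cong) (auto simp: v_def)
    then show "(\<Sum>j\<in>I. A i j * v j * cnj (v i)) =
        (if i = x then \<Sum>j\<in>I. if j = x then A i j else 0 else 0)"
      by (simp add: sum_distrib_right[symmetric] v_def[of i])
  qed
  also have "\<dots> = A x x" using assms(1,2) by simp
  finally show ?thesis using assms(3)[of v] by simp
qed

text \<open>Because \<open>A x x = 0\<close>, the form is affine in K along the vectors e_i - K b
  e_x with b = \<open>A x i\<close>, with slope minus twice the squared modulus of b. It would be
  unbounded below if b were nonzero.\<close>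

lemma psd_zero_diagonal:
  fixes A :: "'i \<Rightarrow> 'i \<Rightarrow> complex"
  assumes I: "finite I" "x \<in> I" "i \<in> I"
    and herm: "\<And>i j. i \<in> I \<Longrightarrow> j \<in> I \<Longrightarrow> A i j = cnj (A j i)"
    and pos: "\<And>v. 0 \<le> (\<Sum>i\<in>I. \<Sum>j\<in>I. A i j * v j * cnj (v i))"
    and zero: "A x x = 0"
  shows "A i x = 0"
proof (rule ccontr)
  assume nz: "A i x \<noteq> 0"
  then have ix: "i \<noteq> x" using zero by auto
  define b where "b = A x i"
  have ai: "A i x = cnj b" using herm[of i x] I by (simp add: b_def)
  have b0: "b \<noteq> 0" using nz ai by auto
  \<comment> \<open>Chosen so that the form takes the value \<open>A i i\<close> - 2 (Re
    (\<open>A i i\<close>) + 1), whose real part is at most -2 because the diagonal entry is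
    nonnegative.\<close>
  define K where "K = (Re (A i i) + 1) / (cmod b)\<^sup>2"
  define v where "v j = (if j = i then 1 else if j = x then - of_real K * b else 0)" for j
  have s: "(\<Sum>j\<in>I. f j * v j) = f i + f x * (- of_real K * b)" for f
  proof -
    have "(\<Sum>j\<in>I. f j * v j) = (\<Sum>j\<in>{i, x}. f j * v j)"
      by (rule sum.mono_neutral_right) (use I in \<open>auto simp: v_def\<close>)
    then show ?thesis using ix by (simp add: v_def)
  qed
  have s': "(\<Sum>j\<in>I. f j * cnj (v j)) = f i + f x * (- of_real K * cnj b)" for f
  proof -
    have "(\<Sum>j\<in>I. f j * cnj (v j)) = (\<Sum>j\<in>{i, x}. f j * cnj (v j))"
      by (rule sum.mono_neutral_right) (use I in \<open>auto simp: v_def\<close>)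
    then show ?thesis using ix by (simp add: v_def)
  qed
  have "(\<Sum>i\<in>I. \<Sum>j\<in>I. A i j * v j * cnj (v i)) = A i i - 2 * of_real K * (b * cnj b)"
    by (simp add: sum_distrib_right[symmetric] s s' zero ai b_def[symmetric])
  also have "\<dots> = A i i - of_real (2 * (Re (A i i) + 1))"
    using b0 by (simp add: K_def complex_norm_square[symmetric] del: of_real_power)
  finally have "0 \<le> Re (A i i) - 2 * (Re (A i i) + 1)"
    using pos[of v] by (simp add: less_eq_complex_def)
  moreover have "0 \<le> Re (A i i)"
    using psd_diagonal[OF I(1,3) pos] by (simp add: less_eq_complex_def)
  ultimately show False by simp
qed

text \<open>Cholesky decomposition: subtracting the rank-one part determined by row \<open>x\<close> leaves the Schur
  complement. If \<open>A x x = 0\<close> then row \<open>x\<close> vanishes, and so does the subtracted part, as \<open>z / 0 = 0\<close>.\<close>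

lemma psd_rank_one_sum:
  fixes A :: "'i \<Rightarrow> 'i \<Rightarrow> complex"
  assumes "finite I"
    and "\<And>i j. i \<in> I \<Longrightarrow> j \<in> I \<Longrightarrow> A i j = cnj (A j i)"
    and "\<And>v. 0 \<le> (\<Sum>i\<in>I. \<Sum>j\<in>I. A i j * v j * cnj (v i))"
  shows "\<exists>(N::nat) w. \<forall>i\<in>I. \<forall>j\<in>I. A i j = (\<Sum>r<N. w r i * cnj (w r j))"
  using assms
proof (induction arbitrary: A rule: finite_induct)
  case (insert x I)
  note herm = insert.prems(1) and pos = insert.prems(2)
  define c where "c = A x x"
  define w where "w i = A i x / of_real (sqrt (Re c))" for i
  define B where "B i j = A i j - A i x * A x j / c" for i j
  have cnjc: "cnj c = c" unfolding c_def using herm[of x x] by simp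
  have c0: "0 \<le> c" unfolding c_def by (rule psd_diagonal[OF _ _ pos]) (use insert.hyps in auto)
  have cR: "c = of_real (Re c)" and Rec: "0 \<le> Re c"
    using c0 by (auto simp: less_eq_complex_def complex_eq_iff)
  have ww: "w i * cnj (w j) = A i x * A x j / c" if "i \<in> insert x I" "j \<in> insert x I" for i j
  proof -
    have "complex_of_real (sqrt (Re c)) * complex_of_real (sqrt (Re c)) = of_real (Re c)"
      unfolding of_real_mult[symmetric] using Rec by (simp only: real_sqrt_mult_self abs_of_nonneg)
    then have "complex_of_real (sqrt (Re c)) * complex_of_real (sqrt (Re c)) = c"
      using cR by (rule trans[OF _ sym])
    moreover have "cnj (A j x) = A x j" using herm[of x j] that by simp
    ultimately show ?thesis by (simp add: w_def)
  qed
  have row: "B i x = 0" "B x i = 0" if i: "i \<in> insert x I" for i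
  proof -
    have "A i x = 0 \<and> A x i = 0" if "c = 0"
    proof -
      have "A i x = 0"
        by (rule psd_zero_diagonal[OF _ _ i herm pos]) (use insert.hyps that in \<open>simp_all add: c_def\<close>)
      then show ?thesis using herm[of x i] i by simp
    qed
    then show "B i x = 0" "B x i = 0" by (cases "c = 0"; simp add: B_def c_def)+
  qed
  have hermB: "B i j = cnj (B j i)" if "i \<in> I" "j \<in> I" for i j
    using that herm[of i j] herm[of i x] herm[of x j] cnjc by (simp add: B_def)
  have posB: "0 \<le> (\<Sum>i\<in>I. \<Sum>j\<in>I. B i j * v j * cnj (v i))" for v
  proof -
    define s where "s = (\<Sum>j\<in>I. A x j * v j)"
    have cs: "cnj s = (\<Sum>j\<in>I. A j x * cnj (v j))"
      unfolding s_def cnj_sum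
    proof (intro sum.cong refl)
      fix j assume "j \<in> I"
      then show "cnj (A x j * v j) = A j x * cnj (v j)" using herm[of j x] by simp
    qed
    \<comment> \<open>Completing the square: with this coordinate at \<open>x\<close>, the form of
      \<open>A\<close> at \<open>u\<close> equals the form of the Schur complement \<open>B\<close>
      at \<open>v\<close>.\<close>
    define u where "u = v(x := - s / c)"
    have uI: "u i = v i" if "i \<in> I" for i
      using that insert.hyps by (auto simp: u_def)
    have ux: "u x = - s / c" by (simp add: u_def)
    have sI: "(\<Sum>j\<in>I. g j * u j) = (\<Sum>j\<in>I. g j * v j)" for g
      by (intro sum.cong refl) (simp add: uI)
    have row: "(\<Sum>j\<in>insert x I. A i j * u j) = A i x * (- s / c) + (\<Sum>j\<in>I. A i j * v j)" for i
      using insert.hyps by (simp add: ux sI)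
    have "(\<Sum>i\<in>insert x I. \<Sum>j\<in>insert x I. A i j * u j * cnj (u i)) =
        (\<Sum>i\<in>insert x I. (A i x * (- s / c) + (\<Sum>j\<in>I. A i j * v j)) * cnj (u i))"
      by (simp only: sum_distrib_right[symmetric] row)
    also have "\<dots> = (c * (- s / c) + s) * cnj (- s / c) +
        (\<Sum>i\<in>I. (A i x * (- s / c) + (\<Sum>j\<in>I. A i j * v j)) * cnj (v i))"
      using insert.hyps by (simp add: ux c_def s_def uI)
    \<comment> \<open>The first factor vanishes if \<open>c\<close> is nonzero; otherwise the second
      does, as division by zero yields zero.\<close>
    also have "(c * (- s / c) + s) * cnj (- s / c) = 0" by simp
    also have "(\<Sum>i\<in>I. (A i x * (- s / c) + (\<Sum>j\<in>I. A i j * v j)) * cnj (v i)) =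
        (\<Sum>i\<in>I. \<Sum>j\<in>I. B i j * v j * cnj (v i))"
    proof (intro sum.cong refl)
      fix i
      have "A i x * (- s / c) + (\<Sum>j\<in>I. A i j * v j) = (\<Sum>j\<in>I. B i j * v j)"
        by (simp add: B_def s_def left_diff_distrib sum_subtractf sum_distrib_left sum_divide_distrib
            mult.assoc)
      then show "(A i x * (- s / c) + (\<Sum>j\<in>I. A i j * v j)) * cnj (v i) =
          (\<Sum>j\<in>I. B i j * v j * cnj (v i))"
        by (simp only: sum_distrib_right)
    qed
    finally show ?thesis using pos[of u] by simp
  qed
  have "\<exists>(N::nat) w. \<forall>i\<in>I. \<forall>j\<in>I. B i j = (\<Sum>r<N. w r i * cnj (w r j))"
    by (rule insert.IH) (fact hermB posB)+
  then obtain N :: nat and w' where w': "\<And>i j. i \<in> I \<Longrightarrow> j \<in> I \<Longrightarrow> B i j = (\<Sum>r<N. w' r i * cnj (w' r j))"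
    by blast
  \<comment> \<open>The vectors for \<open>B\<close> are extended by zero at \<open>x\<close>, which
    agrees with the vanishing row and column of \<open>B\<close> there; the split-off vector
    \<open>w\<close> is appended at index \<open>N\<close>.\<close>
  define w'' where "w'' r i = (if r < N then if i = x then 0 else w' r i else w i)" for r :: nat and i
  have "A i j = (\<Sum>r<Suc N. w'' r i * cnj (w'' r j))" if ij: "i \<in> insert x I" "j \<in> insert x I" for i j
  proof -
    have "(\<Sum>r<N. w'' r i * cnj (w'' r j)) = B i j"
      using ij row w' insert.hyps by (cases "i = x \<or> j = x") (auto simp: w''_def intro!: sum.cong)
    then show ?thesis using ww[OF ij] by (simp add: w''_def B_def)
  qed
  then show ?case by blast
qed simp

lemma psd_rank_one_sum_mat:
  assumes "psd n \<rho>"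
  shows "\<exists>(N::nat) w. \<forall>i\<in>{..<n}. \<forall>j\<in>{..<n}. \<rho> $$ (i, j) = (\<Sum>r<N. w r i * cnj (w r j))"
proof -
  have "0 \<le> (\<Sum>i<n. \<Sum>j<n. \<rho> $$ (i, j) * v j * cnj (v i))" for v
  proof -
    have "0 \<le> (\<Sum>i<n. \<Sum>j<n. \<rho> $$ (i, j) * vec n v $ j * cnj (vec n v $ i))"
      using assms unfolding psd_iff by (meson vec_carrier)
    then show ?thesis by simp
  qed
  moreover have "\<rho> $$ (i, j) = cnj (\<rho> $$ (j, i))" if "i \<in> {..<n}" "j \<in> {..<n}" for i j
    using assms that unfolding psd_iff lessThan_iff by blast
  ultimately show ?thesis by (intro psd_rank_one_sum[of "{..<n}" "\<lambda>i j. \<rho> $$ (i, j)"] finite_lessThan)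
qed

section \<open>Partial evaluation of effects\<close>

abbreviation radix_value :: "('s \<Rightarrow> nat) \<Rightarrow> 's list \<Rightarrow> ('s \<Rightarrow> nat) \<Rightarrow> nat" where
  "radix_value dims xs f \<equiv> foldl (\<lambda>a S. a * dims S + f S) 0 xs"

lemma mult_add_less:
  fixes a b c d :: nat
  assumes "a < c" "b < d"
  shows "a * d + b < c * d"
proof -
  have "a * d + b < Suc a * d" using assms(2) by simp
  also have "\<dots> \<le> c * d" using assms(1) by (intro mult_right_mono) auto
  finally show ?thesis .
qed

lemma mult_add_inject:
  fixes a b c d :: nat
  assumes "a * d + b = c * d + e" "b < d" "e < d"
  shows "a = c \<and> b = e"
proof -
  have "a = (a * d + b) div d" "c = (c * d + e) div d" "b = (a * d + b) mod d" "e = (c * d + e) mod d"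
    using assms(2,3) by auto
  then show ?thesis using assms(1) by metis
qed

text \<open>The last list element is the least significant digit, so \<open>rev_induct\<close>
  reduces this and the next lemmas to one Euclidean division by its radix.\<close>

lemma radix_value_less:
  "\<forall>S\<in>set xs. f S < dims S \<Longrightarrow> radix_value dims xs f < prod_list (map dims xs)"
  by (induction xs rule: rev_induct) (auto intro: mult_add_less)

lemma radix_value_inject:
  "\<lbrakk>\<forall>S\<in>set xs. f S < dims S; \<forall>S\<in>set xs. g S < dims S;
    radix_value dims xs f = radix_value dims xs g\<rbrakk> \<Longrightarrow> \<forall>S\<in>set xs. f S = g S"
proof (induction xs rule: rev_induct)
  case (snoc x xs)
  have "radix_value dims xs f = radix_value dims xs g \<and> f x = g x"
    using snoc.prems by (intro mult_add_inject) auto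
  with snoc show ?case by auto
qed simp

lemma radix_value_cong:
  "\<forall>S\<in>set xs. f S = g S \<Longrightarrow> radix_value dims xs f = radix_value dims xs g"
  by (induction xs rule: rev_induct) auto

lemma radix_value_surj:
  "\<lbrakk>distinct xs; m < prod_list (map dims xs)\<rbrakk> \<Longrightarrow>
    \<exists>f. (\<forall>S\<in>set xs. f S < dims S) \<and> radix_value dims xs f = m"
proof (induction xs arbitrary: m rule: rev_induct)
  case (snoc x xs)
  have m: "m < prod_list (map dims xs) * dims x" using snoc.prems by simp
  then have d: "0 < dims x" by (cases "dims x") auto
  have "m div dims x < prod_list (map dims xs)" using m by (simp add: less_mult_imp_div_less)
  then obtain f where f: "\<forall>S\<in>set xs. f S < dims S" "radix_value dims xs f = m div dims x"
    using snoc by auto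
  \<comment> \<open>Since \<open>xs @ [x]\<close> is distinct, overwriting the digit at
    \<open>x\<close> leaves the leading digits unchanged.\<close>
  define g where "g = f(x := m mod dims x)"
  have "radix_value dims xs g = m div dims x"
    unfolding f(2)[symmetric] using snoc.prems by (intro radix_value_cong) (auto simp: g_def)
  then have "radix_value dims (xs @ [x]) g = m" by (simp add: g_def)
  moreover have "\<forall>S\<in>set (xs @ [x]). g S < dims S" using f d by (auto simp: g_def)
  ultimately show ?case by blast
qed simp

lemma hdim_prod_list: "finite C \<Longrightarrow> hdim dims C = prod_list (map dims (sorted_list_of_set C))"
  unfolding hdim_def using prod.distinct_set_conv_list[of "sorted_list_of_set C" dims] by simp

context
  fixes C :: "'s::linorder set"
  assumes C: "finite C"
begin

lemma basis_index_less:
  "\<forall>S\<in>C. f S < dims S \<Longrightarrow> basis_index dims C f < hdim dims C"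
  unfolding basis_index_def hdim_prod_list[OF C]
  by (rule radix_value_less[of "sorted_list_of_set C", unfolded set_sorted_list_of_set[OF C]])

lemma basis_index_inject:
  "\<lbrakk>\<forall>S\<in>C. f S < dims S; \<forall>S\<in>C. g S < dims S;
    basis_index dims C f = basis_index dims C g\<rbrakk> \<Longrightarrow> \<forall>S\<in>C. f S = g S"
  unfolding basis_index_def
  by (rule radix_value_inject[of "sorted_list_of_set C", unfolded set_sorted_list_of_set[OF C]])

lemma basis_index_cong:
  "\<forall>S\<in>C. f S = g S \<Longrightarrow> basis_index dims C f = basis_index dims C g"
  unfolding basis_index_def
  by (rule radix_value_cong[of "sorted_list_of_set C", unfolded set_sorted_list_of_set[OF C]])

lemma basis_index_surj:
  "m < hdim dims C \<Longrightarrow> \<exists>f. (\<forall>S\<in>C. f S < dims S) \<and> basis_index dims C f = m"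
  unfolding basis_index_def hdim_prod_list[OF C]
  by (rule radix_value_surj[of "sorted_list_of_set C", unfolded set_sorted_list_of_set[OF C]]) simp_all

end

text \<open>Row and column positions are two codes of the same data, an assignment of basis indices
  to the systems in \<open>A \<union> B\<close>. Each code determines the assignment on
  \<open>A \<union> B\<close> and reaches every position, so the relation defining
  \<open>sort_mat\<close> is the graph of a bijection.\<close>

lemma sort_mat_permutation:
  assumes fin: "finite A" "finite B" and disj: "A \<inter> B = {}"
  shows "\<exists>\<sigma>. bij_betw \<sigma> {..<hdim dims A * hdim dims B} {..<hdim dims (A \<union> B)} \<and>
    (\<forall>i<hdim dims (A \<union> B). \<forall>j<hdim dims A * hdim dims B.
      sort_mat dims A B $$ (i, j) = (if i = \<sigma> j then 1 else 0))"
proof -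
  define bd where "bd f \<longleftrightarrow> (\<forall>S\<in>A \<union> B. f S < dims S)" for f
  define \<kappa> where "\<kappa> f = basis_index dims A f * hdim dims B + basis_index dims B f" for f
  let ?b = "basis_index dims (A \<union> B)"
  have fU: "finite (A \<union> B)" using fin by simp
  have agree: "\<kappa> f = \<kappa> g \<longleftrightarrow> (\<forall>S\<in>A \<union> B. f S = g S)" if "bd f" "bd g" for f g
  proof
    assume "\<kappa> f = \<kappa> g"
    note eq = this[unfolded \<kappa>_def]
    have "basis_index dims A f = basis_index dims A g \<and> basis_index dims B f = basis_index dims B g"
      by (rule mult_add_inject[OF eq]; rule basis_index_less; use that fin in \<open>simp add: bd_def\<close>)
    then have e: "basis_index dims A f = basis_index dims A g" "basis_index dims B f = basis_index dims B g"
      by auto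
    have "\<forall>S\<in>A. f S = g S"
      by (rule basis_index_inject[OF fin(1) _ _ e(1)]) (use that in \<open>auto simp: bd_def\<close>)
    moreover have "\<forall>S\<in>B. f S = g S"
      by (rule basis_index_inject[OF fin(2) _ _ e(2)]) (use that in \<open>auto simp: bd_def\<close>)
    ultimately show "\<forall>S\<in>A \<union> B. f S = g S" by blast
  next
    assume "\<forall>S\<in>A \<union> B. f S = g S"
    then show "\<kappa> f = \<kappa> g"
      using basis_index_cong[of A f g dims] basis_index_cong[of B f g dims] fin by (simp add: \<kappa>_def)
  qed
  have agree': "?b f = ?b g \<longleftrightarrow> (\<forall>S\<in>A \<union> B. f S = g S)" if "bd f" "bd g" for f g
    using basis_index_inject[OF fU, of f dims g] basis_index_cong[OF fU, of f g dims] that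
    unfolding bd_def by blast
  have \<kappa>_surj: "\<exists>f. bd f \<and> \<kappa> f = j" if j: "j < hdim dims A * hdim dims B" for j
  proof -
    have pos: "0 < hdim dims B" using j by (cases "hdim dims B") auto
    have "j div hdim dims B < hdim dims A" using j by (simp add: less_mult_imp_div_less)
    then obtain f where f: "\<forall>S\<in>A. f S < dims S" "basis_index dims A f = j div hdim dims B"
      using basis_index_surj[OF fin(1)] by blast
    obtain g where g: "\<forall>S\<in>B. g S < dims S" "basis_index dims B g = j mod hdim dims B"
      using basis_index_surj[OF fin(2) mod_less_divisor[OF pos]] by blast
    \<comment> \<open>Disjointness of \<open>A\<close> and \<open>B\<close> lets the two decoded
      assignments be glued without conflict.\<close>
    define k where "k S = (if S \<in> A then f S else g S)" for S
    have "basis_index dims A k = basis_index dims A f"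
      by (rule basis_index_cong[OF fin(1)]) (simp add: k_def)
    moreover have "basis_index dims B k = basis_index dims B g"
      by (rule basis_index_cong[OF fin(2)]) (use disj in \<open>auto simp: k_def\<close>)
    ultimately have "\<kappa> k = j" by (simp only: \<kappa>_def f g div_mult_mod_eq)
    moreover have "bd k" using f g by (auto simp: bd_def k_def)
    ultimately show ?thesis by blast
  qed
  \<comment> \<open>Decodes a column position. The choice is determined only on
    \<open>A \<union> B\<close>, which is all that \<open>basis_index\<close> reads.\<close>
  define F where "F j = (SOME f. bd f \<and> \<kappa> f = j)" for j
  have F: "bd (F j)" "\<kappa> (F j) = j" if "j < hdim dims A * hdim dims B" for j
    using someI_ex[OF \<kappa>_surj[OF that]] by (auto simp: F_def)
  define \<sigma> where "\<sigma> j = ?b (F j)" for j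
  have \<kappa>_less: "\<kappa> f < hdim dims A * hdim dims B" if "bd f" for f
    unfolding \<kappa>_def
    by (rule mult_add_less; rule basis_index_less; use that fin in \<open>simp add: bd_def\<close>)
  have F\<kappa>: "?b (F (\<kappa> f)) = ?b f" if "bd f" for f
    using agree'[OF F(1)[OF \<kappa>_less[OF that]] that] agree[OF F(1)[OF \<kappa>_less[OF that]] that]
      F(2)[OF \<kappa>_less[OF that]] by simp
  have "bij_betw \<sigma> {..<hdim dims A * hdim dims B} {..<hdim dims (A \<union> B)}"
    unfolding bij_betw_def
  proof (intro conjI inj_onI equalityI subsetI)
    fix x y assume xy: "x \<in> {..<hdim dims A * hdim dims B}" "y \<in> {..<hdim dims A * hdim dims B}" "\<sigma> x = \<sigma> y"
    then have bd: "bd (F x)" "bd (F y)" using F(1) by auto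
    have "\<kappa> (F x) = \<kappa> (F y)"
      using xy(3) unfolding agree[OF bd] agree'[OF bd, symmetric] \<sigma>_def .
    then show "x = y" using F xy by simp
  next
    fix i assume "i \<in> \<sigma> ` {..<hdim dims A * hdim dims B}"
    then show "i \<in> {..<hdim dims (A \<union> B)}"
      using F(1) basis_index_less[OF fU] by (auto simp: \<sigma>_def bd_def)
  next
    fix i assume "i \<in> {..<hdim dims (A \<union> B)}"
    then obtain f where f: "bd f" "?b f = i" using basis_index_surj[OF fU] by (auto simp: bd_def)
    then show "i \<in> \<sigma> ` {..<hdim dims A * hdim dims B}"
      using F\<kappa>[OF f(1)] \<kappa>_less[OF f(1)] by (intro image_eqI[of _ _ "\<kappa> f"]) (auto simp: \<sigma>_def)
  qed
  moreover have "sort_mat dims A B $$ (i, j) = (if i = \<sigma> j then 1 else 0)"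
    if ij: "i < hdim dims (A \<union> B)" "j < hdim dims A * hdim dims B" for i j
  proof -
    have "(\<exists>f. bd f \<and> i = ?b f \<and> j = \<kappa> f) \<longleftrightarrow> i = \<sigma> j"
    proof
      assume "\<exists>f. bd f \<and> i = ?b f \<and> j = \<kappa> f"
      then show "i = \<sigma> j" using F\<kappa> by (auto simp: \<sigma>_def)
    next
      assume "i = \<sigma> j"
      then show "\<exists>f. bd f \<and> i = ?b f \<and> j = \<kappa> f"
        using F[OF ij(2)] by (intro exI[of _ "F j"]) (simp add: \<sigma>_def)
    qed
    then show ?thesis using ij unfolding sort_mat_def bd_def \<kappa>_def by simp
  qed
  ultimately show ?thesis by (intro exI[of _ \<sigma>]) simp
qed

section \<open>Conjugation by a permutation matrix\<close>

lemma index_mult_sum: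
  fixes A B :: "complex mat"
  assumes "A \<in> carrier_mat n m" "B \<in> carrier_mat m k" "i < n" "j < k"
  shows "(A * B) $$ (i, j) = (\<Sum>l<m. A $$ (i, l) * B $$ (l, j))"
proof -
  have "(A * B) $$ (i, j) = row A i \<bullet> col B j" using assms by simp
  also have "\<dots> = (\<Sum>l<m. row A i $ l * col B j $ l)"
    using assms by (simp add: scalar_prod_def lessThan_atLeast0)
  also have "\<dots> = (\<Sum>l<m. A $$ (i, l) * B $$ (l, j))"
    using assms by (intro sum.cong refl) simp
  finally show ?thesis .
qed

context
  fixes P :: "complex mat" and \<sigma> n m
  assumes P: "P \<in> carrier_mat n m"
    and bij: "bij_betw \<sigma> {..<m} {..<n}"
    and P_index: "\<And>i j. i < n \<Longrightarrow> j < m \<Longrightarrow> P $$ (i, j) = (if i = \<sigma> j then 1 else 0)"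
begin

lemma perm_less: "j < m \<Longrightarrow> \<sigma> j < n"
  using bij by (auto simp: bij_betw_def)

lemma perm_inj: "i < m \<Longrightarrow> j < m \<Longrightarrow> \<sigma> i = \<sigma> j \<longleftrightarrow> i = j"
  using bij by (auto simp: bij_betw_def inj_on_def)

lemma adjoint_perm: "mat_adjoint P \<in> carrier_mat m n"
  "i < n \<Longrightarrow> j < m \<Longrightarrow> mat_adjoint P $$ (j, i) = (if i = \<sigma> j then 1 else 0)"
  using mat_adjoint_carrier[OF P] mat_adjoint_index[OF P] P_index by auto

lemma adjoint_perm_mult:
  assumes "M \<in> carrier_mat n k" "j < m" "l < k"
  shows "(mat_adjoint P * M) $$ (j, l) = M $$ (\<sigma> j, l)"
proof -
  have "(mat_adjoint P * M) $$ (j, l) = (\<Sum>i<n. (if i = \<sigma> j then M $$ (i, l) else 0))"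
    using assms unfolding index_mult_sum[OF adjoint_perm(1) assms]
    by (intro sum.cong) (auto simp: adjoint_perm(2))
  then show ?thesis using perm_less[OF assms(2)] by simp
qed

lemma mult_perm:
  assumes "M \<in> carrier_mat k n" "l < k" "j < m"
  shows "(M * P) $$ (l, j) = M $$ (l, \<sigma> j)"
proof -
  have "(M * P) $$ (l, j) = (\<Sum>i<n. (if i = \<sigma> j then M $$ (l, i) else 0))"
    unfolding index_mult_sum[OF assms(1) P assms(2,3)]
    using assms by (intro sum.cong) (auto simp: P_index)
  then show ?thesis using perm_less[OF assms(3)] by simp
qed

lemma perm_mult:
  assumes "M \<in> carrier_mat m k" "j < m" "l < k"
  shows "(P * M) $$ (\<sigma> j, l) = M $$ (j, l)"
proof -
  have "(P * M) $$ (\<sigma> j, l) = (\<Sum>i<m. (if i = j then M $$ (i, l) else 0))"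
    unfolding index_mult_sum[OF P assms(1) perm_less[OF assms(2)] assms(3)]
    using assms perm_less by (intro sum.cong) (auto simp: P_index perm_inj)
  then show ?thesis using assms(2) by simp
qed

lemma mult_adjoint_perm:
  assumes "M \<in> carrier_mat k m" "l < k" "j < m"
  shows "(M * mat_adjoint P) $$ (l, \<sigma> j) = M $$ (l, j)"
proof -
  have "(M * mat_adjoint P) $$ (l, \<sigma> j) = (\<Sum>i<m. (if i = j then M $$ (l, i) else 0))"
    unfolding index_mult_sum[OF assms(1) adjoint_perm(1) assms(2) perm_less[OF assms(3)]]
    using assms perm_less by (intro sum.cong) (auto simp: adjoint_perm(2) perm_inj)
  then show ?thesis using assms(3) by simp
qed

text \<open>The outer conjugation reads off the entry at \<open>(\<sigma> i, \<sigma> j)\<close>.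
  Reindexing the inner product sum along \<open>\<sigma>\<close> then undoes the conjugation of
  \<open>K\<close>, leaving only \<open>L\<close> relabelled.\<close>

lemma perm_conjugate_mult:
  assumes L: "L \<in> carrier_mat n n" and K: "K \<in> carrier_mat m m" and ij: "i < m" "j < m"
  shows "(mat_adjoint P * (L * (P * K * mat_adjoint P)) * P) $$ (i, j) =
    (\<Sum>x<m. L $$ (\<sigma> i, \<sigma> x) * K $$ (x, j))"
proof -
  note c = P adjoint_perm(1) L K
  let ?K = "P * K * mat_adjoint P"
  have cK: "?K \<in> carrier_mat n n" "P * K \<in> carrier_mat n m" using c by auto
  have cM: "L * ?K \<in> carrier_mat n n" using cK c by auto
  have "(mat_adjoint P * (L * ?K) * P) $$ (i, j) = (L * ?K) $$ (\<sigma> i, \<sigma> j)"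
    using mult_perm[OF mult_carrier_mat[OF adjoint_perm(1) cM] ij]
      adjoint_perm_mult[OF cM ij(1) perm_less[OF ij(2)]] by (rule trans)
  also have "\<dots> = (\<Sum>x<n. L $$ (\<sigma> i, x) * ?K $$ (x, \<sigma> j))"
    by (rule index_mult_sum[OF L cK(1) perm_less perm_less]) (use ij in auto)
  also have "\<dots> = (\<Sum>x<m. L $$ (\<sigma> i, \<sigma> x) * ?K $$ (\<sigma> x, \<sigma> j))"
    by (rule sum.reindex_bij_betw[OF bij, symmetric])
  also have "\<dots> = (\<Sum>x<m. L $$ (\<sigma> i, \<sigma> x) * K $$ (x, j))"
    using ij perm_less by (intro sum.cong refl) (simp add: mult_adjoint_perm[OF cK(2)] perm_mult[OF K])
  finally show ?thesis .
qed

end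

section \<open>Partial evaluation in coordinates\<close>

lemma sum_lessThan_add:
  "(\<Sum>x<a + b. f x) = (\<Sum>x<a. f x) + (\<Sum>y<b. f (a + y :: nat))"
  by (induction b) (simp_all add: add.assoc)

lemma sum_lessThan_mult:
  "(\<Sum>x<a * b. f x) = (\<Sum>l<a. \<Sum>y<b. f (l * b + y :: nat))"
proof (induction a)
  case (Suc a)
  have "(\<Sum>x<Suc a * b. f x) = (\<Sum>x<a * b + b. f x)" by (simp add: add.commute)
  also have "\<dots> = (\<Sum>x<a * b. f x) + (\<Sum>y<b. f (a * b + y))"
    by (rule sum_lessThan_add)
  finally show ?case using Suc by simp
qed simp

text \<open>\<open>\<pi> (k, i)\<close> is the position in the Kronecker product over \<open>C\<close> of the tensor product of
  the basis vector \<open>k\<close> over \<open>C'\<close> and the basis vector \<open>i\<close> over \<open>C - C'\<close>.\<close>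

lemma partial_eval_index:
  fixes dims :: "'s::linorder \<Rightarrow> nat"
  assumes C: "finite C" "C' \<subseteq> C"
  defines "n \<equiv> hdim dims C" and "a \<equiv> hdim dims C'" and "b \<equiv> hdim dims (C - C')"
  shows "\<exists>\<pi>. bij_betw \<pi> ({..<a} \<times> {..<b}) {..<n} \<and>
    (\<forall>\<rho>\<in>carrier_mat a a. \<forall>L\<in>carrier_mat n n. partial_eval dims C C' \<rho> L =
      mat b b (\<lambda>(i, j). \<Sum>k<a. \<Sum>l<a. L $$ (\<pi> (k, i), \<pi> (l, j)) * \<rho> $$ (l, k)))"
proof -
  have CU: "C' \<union> (C - C') = C" using C by auto
  obtain \<sigma> where bij: "bij_betw \<sigma> {..<a * b} {..<n}"
    and "\<forall>i<n. \<forall>j<a * b. sort_mat dims C' (C - C') $$ (i, j) = (if i = \<sigma> j then 1 else 0)"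
    using sort_mat_permutation[OF finite_subset[OF C(2,1)] finite_Diff[OF C(1), of C'] Diff_disjoint, of dims]
    unfolding CU n_def[symmetric] a_def[symmetric] b_def[symmetric] by (elim exE conjE)
  then have S: "\<And>i j. i < n \<Longrightarrow> j < a * b \<Longrightarrow>
      sort_mat dims C' (C - C') $$ (i, j) = (if i = \<sigma> j then 1 else 0)"
    by blast
  let ?P = "sort_mat dims C' (C - C')"
  have P: "?P \<in> carrier_mat n (a * b)" unfolding sort_mat_def CU n_def a_def b_def by (rule mat_carrier)
  define \<pi> where "\<pi> = \<sigma> \<circ> (\<lambda>(k, i). k * b + i)"
  have "bij_betw (\<lambda>(k, i). k * b + i) ({..<a} \<times> {..<b}) {..<a * b}"
    unfolding bij_betw_def
  proof (intro conjI inj_onI equalityI subsetI)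
    fix x y assume "x \<in> {..<a} \<times> {..<b}" "y \<in> {..<a} \<times> {..<b}"
      "(case x of (k, i) \<Rightarrow> k * b + i) = (case y of (k, i) \<Rightarrow> k * b + i)"
    then show "x = y" using mult_add_inject[of "fst x" b "snd x" "fst y" "snd y"] by (cases x; cases y) simp
  next
    fix x assume "x \<in> (\<lambda>(k, i). k * b + i) ` ({..<a} \<times> {..<b})"
    then show "x \<in> {..<a * b}" using mult_add_less by auto
  next
    fix x assume x: "x \<in> {..<a * b}"
    then have "0 < b" by (cases b) auto
    then show "x \<in> (\<lambda>(k, i). k * b + i) ` ({..<a} \<times> {..<b})"
      using x by (intro image_eqI[of _ _ "(x div b, x mod b)"]) (auto simp: less_mult_imp_div_less)
  qed
  then have "bij_betw \<pi> ({..<a} \<times> {..<b}) {..<n}"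
    unfolding \<pi>_def using bij by (rule bij_betw_trans)
  moreover have "partial_eval dims C C' \<rho> L =
      mat b b (\<lambda>(i, j). \<Sum>k<a. \<Sum>l<a. L $$ (\<pi> (k, i), \<pi> (l, j)) * \<rho> $$ (l, k))"
    if \<rho>: "\<rho> \<in> carrier_mat a a" and L: "L \<in> carrier_mat n n" for \<rho> L
  proof -
    let ?K = "kron \<rho> (1\<^sub>m b)"
    have K: "?K \<in> carrier_mat (a * b) (a * b)" using \<rho> by (simp add: kron_def)
    have "(\<Sum>x<a * b. L $$ (\<sigma> (k * b + i), \<sigma> x) * ?K $$ (x, k * b + j)) =
        (\<Sum>l<a. L $$ (\<pi> (k, i), \<pi> (l, j)) * \<rho> $$ (l, k))"
      if "k < a" "i < b" "j < b" for i j k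
    proof -
      \<comment> \<open>The identity factor forces the second coordinate to be \<open>j\<close>,
        which collapses the block sum to a sum over \<open>l\<close> alone.\<close>
      have "?K $$ (l * b + y, k * b + j) = (if y = j then \<rho> $$ (l, k) else 0)"
        if "l < a" "y < b" for l y
        using that \<rho> \<open>k < a\<close> \<open>j < b\<close> mult_add_less[OF \<open>l < a\<close> \<open>y < b\<close>] mult_add_less[OF \<open>k < a\<close> \<open>j < b\<close>]
        by (simp add: kron_def)
      then have "(\<Sum>x<a * b. L $$ (\<sigma> (k * b + i), \<sigma> x) * ?K $$ (x, k * b + j)) =
          (\<Sum>l<a. \<Sum>y<b. if y = j then L $$ (\<sigma> (k * b + i), \<sigma> (l * b + y)) * \<rho> $$ (l, k) else 0)"
        unfolding sum_lessThan_mult by (intro sum.cong refl) auto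
      then show ?thesis using that by (simp add: \<pi>_def)
    qed
    moreover have "(mat_adjoint ?P * (L * (?P * ?K * mat_adjoint ?P)) * ?P) $$ (k * b + i, k * b + j) =
        (\<Sum>x<a * b. L $$ (\<sigma> (k * b + i), \<sigma> x) * ?K $$ (x, k * b + j))"
      if "k < a" "i < b" "j < b" for i j k
      using that by (intro perm_conjugate_mult[OF P bij S L K] mult_add_less) auto
    ultimately show ?thesis
      unfolding partial_eval_def partial_trace_def boxtimes_def Let_def a_def[symmetric] b_def[symmetric]
      by (intro eq_matI) (auto intro!: sum.cong)
  qed
  ultimately show ?thesis by (intro exI[of _ \<pi>]) simp
qed

text \<open>Substituting \<open>\<rho> $$ (l, k)\<close> = sum over r of
  \<open>w r l * cnj (w r k)\<close> turns the form at \<open>v\<close> into a sum over r of the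
  form of \<open>L\<close> at w_r tensor v. The Hermitian symmetry follows by exchanging the roles
  of \<open>k\<close> and \<open>l\<close>.\<close>

lemma psd_trace_out:
  assumes L: "psd n L" and \<rho>: "psd a \<rho>" and bij: "bij_betw \<pi> ({..<a} \<times> {..<b}) {..<n}"
  shows "psd b (mat b b (\<lambda>(i, j). \<Sum>k<a. \<Sum>l<a. L $$ (\<pi> (k, i), \<pi> (l, j)) * \<rho> $$ (l, k)))"
    (is "psd b ?M")
  unfolding psd_iff
proof (intro conjI allI impI ballI)
  have \<pi>: "\<pi> (k, i) < n" if "k < a" "i < b" for k i
    using bij_betwE[OF bij] that by auto
  fix i j assume ij: "i < b" "j < b"
  have "cnj (?M $$ (j, i)) = (\<Sum>k<a. \<Sum>l<a. cnj (L $$ (\<pi> (k, j), \<pi> (l, i))) * cnj (\<rho> $$ (l, k)))"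
    using ij by simp
  also have "\<dots> = (\<Sum>k<a. \<Sum>l<a. L $$ (\<pi> (l, i), \<pi> (k, j)) * \<rho> $$ (k, l))"
  proof (intro sum.cong refl)
    fix k l assume "k \<in> {..<a}" "l \<in> {..<a}"
    then have kl: "k < a" "l < a" by auto
    have "L $$ (\<pi> (l, i), \<pi> (k, j)) = cnj (L $$ (\<pi> (k, j), \<pi> (l, i)))"
      using L \<pi> kl ij unfolding psd_iff by blast
    moreover have "\<rho> $$ (k, l) = cnj (\<rho> $$ (l, k))" using \<rho> kl unfolding psd_iff by blast
    ultimately show "cnj (L $$ (\<pi> (k, j), \<pi> (l, i))) * cnj (\<rho> $$ (l, k)) =
        L $$ (\<pi> (l, i), \<pi> (k, j)) * \<rho> $$ (k, l)" by (simp only:)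
  qed
  also have "\<dots> = ?M $$ (i, j)" using ij by (subst sum.swap) simp
  finally show "?M $$ (i, j) = cnj (?M $$ (j, i))" by (rule sym)
next
  fix v :: "complex vec"
  assume "v \<in> carrier_vec b"
  obtain N :: nat and w where
    "\<forall>i\<in>{..<a}. \<forall>j\<in>{..<a}. \<rho> $$ (i, j) = (\<Sum>r<N. w r i * cnj (w r j))"
    using psd_rank_one_sum_mat[OF \<rho>] by (elim exE)
  then have w: "\<And>i j. i < a \<Longrightarrow> j < a \<Longrightarrow> \<rho> $$ (i, j) = (\<Sum>r<N. w r i * cnj (w r j))"
    by simp
  let ?Q = "\<lambda>u. \<Sum>x<n. \<Sum>y<n. L $$ (x, y) * u $ y * cnj (u $ x)"
  \<comment> \<open>The vector w_r tensor v, with its coordinates placed by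
    \<open>\<pi>\<close>.\<close>
  define u where "u r = vec n (\<lambda>x. case inv_into ({..<a} \<times> {..<b}) \<pi> x of (l, j) \<Rightarrow> w r l * v $ j)" for r
  have u: "u r $ \<pi> (l, j) = w r l * v $ j" if "l < a" "j < b" for r l j
    using that bij_betwE[OF bij] bij_betw_inv_into_left[OF bij, of "(l, j)"] by (auto simp: u_def)
  have split: "(\<Sum>x<n. f x) = (\<Sum>l<a. \<Sum>j<b. f (\<pi> (l, j)))" for f :: "nat \<Rightarrow> complex"
    unfolding sum.reindex_bij_betw[OF bij, symmetric] by (simp add: sum.cartesian_product)
  define t where "t i j k l r = L $$ (\<pi> (k, i), \<pi> (l, j)) * (w r l * v $ j) * cnj (w r k * v $ i)"
    for i j k l r
  have "(\<Sum>i<b. \<Sum>j<b. ?M $$ (i, j) * v $ j * cnj (v $ i)) =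
      (\<Sum>i<b. \<Sum>j<b. \<Sum>k<a. \<Sum>l<a. \<Sum>r<N. t i j k l r)"
  proof (intro sum.cong refl)
    fix i j assume "i \<in> {..<b}" "j \<in> {..<b}"
    then have "?M $$ (i, j) * v $ j * cnj (v $ i) =
        (\<Sum>k<a. \<Sum>l<a. L $$ (\<pi> (k, i), \<pi> (l, j)) * \<rho> $$ (l, k) * v $ j * cnj (v $ i))"
      by (simp add: sum_distrib_right)
    also have "\<dots> = (\<Sum>k<a. \<Sum>l<a. \<Sum>r<N. t i j k l r)"
      by (intro sum.cong refl) (simp add: w t_def sum_distrib_left sum_distrib_right mult_ac)
    finally show "?M $$ (i, j) * v $ j * cnj (v $ i) = (\<Sum>k<a. \<Sum>l<a. \<Sum>r<N. t i j k l r)" .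
  qed
  \<comment> \<open>Regrouping pairs \<open>k\<close> with \<open>i\<close> for the row and
    \<open>l\<close> with \<open>j\<close> for the column, so that each inner fourfold sum is a
    quadratic form of \<open>L\<close>.\<close>
  also have "\<dots> = (\<Sum>r<N. \<Sum>k<a. \<Sum>i<b. \<Sum>l<a. \<Sum>j<b. t i j k l r)"
    unfolding sum.cartesian_product
    by (rule sum.reindex_bij_witness[of _ "\<lambda>(r, k, i, l, j). (i, j, k, l, r)"
          "\<lambda>(i, j, k, l, r). (r, k, i, l, j)"]) auto
  also have "\<dots> = (\<Sum>r<N. ?Q (u r))"
    unfolding split by (intro sum.cong refl) (simp add: u t_def)
  also have "0 \<le> \<dots>"
  proof (rule sum_nonneg)
    fix r
    have "u r \<in> carrier_vec n" by (simp add: u_def)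
    then show "0 \<le> ?Q (u r)" using L unfolding psd_iff by blast
  qed
  finally show "0 \<le> (\<Sum>i<b. \<Sum>j<b. ?M $$ (i, j) * v $ j * cnj (v $ i))" .
qed simp

lemma pcm_hom_partial_eval:
  fixes dims :: "'s::linorder \<Rightarrow> nat"
  assumes C: "finite C" "C' \<subseteq> C" and \<rho>: "\<rho> \<in> density (hdim dims C')"
  shows "pcm_hom (Ef (hdim dims C)) (Ef (hdim dims (C - C'))) (partial_eval dims C C' \<rho>)"
proof -
  define n a b where "n = hdim dims C" and "a = hdim dims C'" and "b = hdim dims (C - C')"
  note d = n_def[symmetric] a_def[symmetric] b_def[symmetric]
  have psd\<rho>: "psd a \<rho>" and tr: "(\<Sum>i<a. \<rho> $$ (i, i)) = 1" using \<rho> by (auto simp: density_def d)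
  then have c\<rho>: "\<rho> \<in> carrier_mat a a" by (simp add: psd_def)
  obtain \<pi> where bij: "bij_betw \<pi> ({..<a} \<times> {..<b}) {..<n}"
    and "\<forall>\<rho>\<in>carrier_mat a a. \<forall>L\<in>carrier_mat n n. partial_eval dims C C' \<rho> L =
      mat b b (\<lambda>(i, j). \<Sum>k<a. \<Sum>l<a. L $$ (\<pi> (k, i), \<pi> (l, j)) * \<rho> $$ (l, k))"
    using partial_eval_index[OF C, of dims] unfolding d by (elim exE conjE)
  note eval = this(2)[rule_format, OF c\<rho>]
  let ?p = "partial_eval dims C C' \<rho>"
  have \<pi>: "\<pi> (k, i) < n" if "k < a" "i < b" for k i
    using bij_betwE[OF bij] that by auto
  have \<pi>_inj: "\<pi> (k, i) = \<pi> (l, j) \<longleftrightarrow> k = l \<and> i = j" if "k < a" "i < b" "l < a" "j < b" for k i l j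
    using bij that by (auto simp: bij_betw_def inj_on_def)
  have carrier: "?p L \<in> carrier_mat b b" if "L \<in> carrier_mat n n" for L
    using that by (simp add: eval)
  have zero: "?p (0\<^sub>m n n) = 0\<^sub>m b b"
    by (intro eq_matI) (simp_all add: eval \<pi>)
  have add: "?p (L + M) = ?p L + ?p M" if "L \<in> carrier_mat n n" "M \<in> carrier_mat n n" for L M
    using that by (intro eq_matI) (simp_all add: eval \<pi> distrib_right sum.distrib)
  have one: "?p (1\<^sub>m n) = 1\<^sub>m b"
  proof (intro eq_matI)
    fix i j assume "i < dim_row (1\<^sub>m b :: complex mat)" "j < dim_col (1\<^sub>m b :: complex mat)"
    then have ij: "i < b" "j < b" by auto
    have e: "(1\<^sub>m n :: complex mat) $$ (\<pi> (k, i), \<pi> (l, j)) = (if k = l then if i = j then 1 else 0 else 0)"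
      if "k < a" "l < a" for k l
      using that ij \<pi> \<pi>_inj by simp
    have "?p (1\<^sub>m n) $$ (i, j) = (\<Sum>k<a. \<Sum>l<a. 1\<^sub>m n $$ (\<pi> (k, i), \<pi> (l, j)) * \<rho> $$ (l, k))"
      using ij by (simp add: eval)
    also have "\<dots> = (\<Sum>k<a. \<Sum>l<a. if k = l then if i = j then \<rho> $$ (l, k) else 0 else 0)"
      by (intro sum.cong refl) (simp add: e)
    \<comment> \<open>Only the diagonal of \<open>\<rho>\<close> survives, and its sum is 1.\<close>
    also have "\<dots> = 1\<^sub>m b $$ (i, j)" using ij tr by (simp add: sum.delta)
    finally show "?p (1\<^sub>m n) $$ (i, j) = 1\<^sub>m b $$ (i, j)" .
  qed (simp_all add: eval)
  \<comment> \<open>Lets positivity be applied to complements, which transfers the upper bounds on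
    effects and on their sums.\<close>
  have compl: "?p (1\<^sub>m n - L) = 1\<^sub>m b - ?p L" if L: "L \<in> carrier_mat n n" for L
  proof -
    have c1: "1\<^sub>m n - L \<in> carrier_mat n n" using L by (rule minus_carrier_mat)
    have "(1\<^sub>m n - L) + L = 1\<^sub>m n" using L by (intro eq_matI) auto
    then have "1\<^sub>m b - ?p L = (?p (1\<^sub>m n - L) + ?p L) - ?p L"
      using add[OF c1 L] by (simp only: one)
    also have "\<dots> = ?p (1\<^sub>m n - L)"
      using carrier[OF c1] carrier[OF L] by (intro eq_matI) auto
    finally show ?thesis by (rule sym)
  qed
  have psd: "psd b (?p L)" if "psd n L" for L
    using psd_trace_out[OF that psd\<rho> bij] that by (simp add: eval psd_def)
  have eff: "?p L \<in> effects b" if "L \<in> effects n" for L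
    using that psd[of L] psd[of "1\<^sub>m n - L"] compl[of L] carrier[of L] by (simp add: effects_iff)
  have c: "L \<in> carrier_mat n n" if "L \<in> effects n" for L using that by (simp add: effects_iff)
  have "pcm (Ef k)" for k using effect_algebra_Ef[of k] by (simp add: effect_algebra_def)
  moreover have "perp (Ef b) (?p L) (?p M) \<and> ?p (padd (Ef n) L M) = padd (Ef b) (?p L) (?p M)"
    if "perp (Ef n) L M" for L M
  proof -
    have LM: "L \<in> effects n" "M \<in> effects n" "psd n (1\<^sub>m n - (L + M))"
      using that by (auto simp: Ef_def loewner_le_def)
    have "psd b (1\<^sub>m b - (?p L + ?p M))"
      using psd[OF LM(3)] compl[of "L + M"] add[of L M] c LM by simp
    then show ?thesis
      using LM c eff add carrier by (auto simp: Ef_def loewner_le_def)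
  qed
  ultimately show ?thesis
    unfolding d by (intro pcm_hom.intro pcm_hom_axioms.intro) (auto simp: Ef_def zero eff)
qed

lemma kernel_bisimilar_partial_eval:
  fixes U :: "'u set set"
  assumes C: "finite C" "C' \<subseteq> C" and \<rho>: "\<rho> \<in> density (hdim dims C')"
    and bisim: "kernel_bisimilar U (qlts_functor dims C L) A B s t"
  shows "kernel_bisimilar U (qlts_functor dims (C - C') L)
    (qlts_partial_eval dims C C' \<rho> L A) (qlts_partial_eval dims C C' \<rho> L B) s t"
proof -
  interpret pcm_hom "Ef (hdim dims C)" "Ef (hdim dims (C - C'))" "partial_eval dims C C' \<rho>"
    by (rule pcm_hom_partial_eval[OF C \<rho>])
  have eq: "qlts_partial_eval dims C C' \<rho> L D = lts_transform L (\<lambda>X. compose X (partial_eval dims C C' \<rho>)) D" for D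
    by (cases D) (auto simp: qlts_partial_eval_def lts_transform_def lts_map_def image_def intro!: restrict_ext)
  have obj: "obj (dist_functor E) X = dist E X" for E :: "complex mat effect_algebra" and X :: "'u set"
    by (simp add: dist_functor_def)
  show ?thesis
    using bisim unfolding qlts_functor_def eq
    by (rule kernel_bisimilar_lts_transform[rotated 2]) (auto simp: obj dist_functor_compose dist_compose)
qed

section \<open>Parallel composition\<close>

lemma cprod_map_pr:
  "\<lbrakk>inj pr; x \<in> X; y \<in> Y\<rbrakk> \<Longrightarrow> cprod_map pr X Y f g (pr (x, y)) = pr (f x, g y)"
  by (simp add: cprod_map_def cprod_def)

lemma cprod_map_type:
  "\<lbrakk>inj pr; f \<in> X \<rightarrow>\<^sub>E X'; g \<in> Y \<rightarrow>\<^sub>E Y'\<rbrakk> \<Longrightarrow> cprod_map pr X Y f g \<in> cprod pr X Y \<rightarrow>\<^sub>E cprod pr X' Y'"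
  by (auto simp: cprod_map_def cprod_def)

abbreviation sync_succ where
  "sync_succ pr T m n L \<tau> bar A B p \<mu> \<equiv> {\<Delta>. sync_step pr T m n L \<tau> bar A B p \<mu> \<Delta>}"

text \<open>Written as a union of products, the successors can be compared through images, because
  images under a product map commute with products and unions.\<close>

lemma sync_succ_eq:
  assumes "inj pr" "s \<in> X" "t \<in> Y" "\<mu> \<in> L"
  shows "sync_succ pr T m n L \<tau> bar (X, c) (Y, d) (pr (s, t)) \<mu> =
    pr ` (c s \<mu> \<times> {gpoint T n Y t} \<union> {gpoint T m X s} \<times> d t \<mu> \<union>
      (if \<mu> = \<tau> then \<Union>\<nu>\<in>L - {\<tau>}. c s \<nu> \<times> d t (bar \<nu>) else {}))"
    (is "?S = pr ` ?R")
proof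
  show "?S \<subseteq> pr ` ?R"
    using assms(1) by (auto simp: inj_eq elim!: sync_step.cases)
  show "pr ` ?R \<subseteq> ?S"
  proof
    fix z assume "z \<in> pr ` ?R"
    then consider \<Delta> where "\<Delta> \<in> c s \<mu>" "z = pr (\<Delta>, gpoint T n Y t)"
      | \<Theta> where "\<Theta> \<in> d t \<mu>" "z = pr (gpoint T m X s, \<Theta>)"
      | \<nu> \<Delta> \<Theta> where "\<mu> = \<tau>" "\<nu> \<in> L - {\<tau>}" "\<Delta> \<in> c s \<nu>" "\<Theta> \<in> d t (bar \<nu>)" "z = pr (\<Delta>, \<Theta>)"
      by (cases "\<mu> = \<tau>") (simp, blast, auto)
    then show "z \<in> ?S"
      using assms sync_step.left[of s "(X, c)" t "(Y, d)" \<mu> L _ pr T m n \<tau> bar]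
        sync_step.right[of s "(X, c)" t "(Y, d)" \<mu> L _ pr T m n \<tau> bar]
        sync_step.both[of s "(X, c)" t "(Y, d)" _ L \<tau> _ _ bar pr T m n]
      by cases auto
  qed
qed

context extensible_graded_monad
begin

lemma zero_preceq: "k \<in> elems (grades T) \<Longrightarrow> preceq (grades T) (pzero (grades T)) k"
  using pcm.zero_add[OF pcm] by (auto simp: preceq_def)

lemma gpoint_type:
  "\<lbrakk>k \<in> elems (grades T); X \<in> U; x \<in> X\<rbrakk> \<Longrightarrow> gpoint T k X x \<in> tobj T k X"
  unfolding gpoint_def by (rule PiE_mem[OF ext_type[OF zero_preceq] PiE_mem[OF unit_type]])

lemma gpoint_natural:
  assumes "k \<in> elems (grades T)" "X \<in> U" "Y \<in> U" "f \<in> X \<rightarrow>\<^sub>E Y" "x \<in> X"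
  shows "tmor T k X Y f (gpoint T k X x) = gpoint T k Y (f x)"
proof -
  have "gunit T X x \<in> tobj T (pzero (grades T)) X" using unit_type[OF assms(2)] assms(5) by auto
  then show ?thesis
    using ext_natural[OF zero_preceq[OF assms(1)] assms(2-4)] unit_natural[OF assms(2-5)]
    by (simp add: gpoint_def)
qed

end

section \<open>Homomorphisms between parallel compositions\<close>

locale graded_parallel = set_universe U pr + extensible_graded_monad U T + sync_labels L \<tau> bar
  for U :: "'u set set" and pr and T :: "('m, 'u) graded_monad" and L :: "'l set" and \<tau> bar +
  fixes m n \<alpha>
  assumes perp: "perp (grades T) m n" and pairing: "natural_pairing U pr T m n \<alpha>"
begin

abbreviation succ where "succ \<equiv> sync_succ pr T m n L \<tau> bar"

lemma grade_elems: "m \<in> elems (grades T)" "n \<in> elems (grades T)"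
  using pcm.perp_elems[OF pcm perp] by auto

lemma coalgebraD:
  assumes "coalgebra U (lts_functor L F) (X, c)"
  shows "X \<in> U" "\<And>x \<mu>. x \<in> X \<Longrightarrow> \<mu> \<in> L \<Longrightarrow> c x \<mu> \<in> Fpow (obj F X)"
    "\<And>x. x \<in> X \<Longrightarrow> c x \<in> L \<rightarrow>\<^sub>E Fpow (obj F X)"
proof -
  have c: "X \<in> U" "c \<in> X \<rightarrow>\<^sub>E L \<rightarrow>\<^sub>E Fpow (obj F X)"
    using assms by (simp_all add: coalgebra_def lts_functor_def)
  show "X \<in> U" by (fact c)
  show 1: "c x \<in> L \<rightarrow>\<^sub>E Fpow (obj F X)" if "x \<in> X" for x
    using PiE_mem[OF c(2) that] .
  show "c x \<mu> \<in> Fpow (obj F X)" if "x \<in> X" "\<mu> \<in> L" for x \<mu>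
    using PiE_mem[OF 1 that(2)] that(1) .
qed

lemma coalgebra_homD:
  assumes "coalgebra_hom U (lts_functor L F) f (X, c) (Y, d)" "x \<in> X" "\<mu> \<in> L"
  shows "d (f x) \<mu> = mor F X Y f ` c x \<mu>"
proof -
  have "c x \<in> L \<rightarrow>\<^sub>E Fpow (obj F X)"
    by (rule coalgebraD(3)) (use assms in \<open>auto simp: coalgebra_hom_def\<close>)
  moreover have "mor (lts_functor L F) X Y f (c x) = d (f x)"
    using assms by (simp add: coalgebra_hom_def)
  ultimately have "d (f x) = lts_map L (mor F X Y f) (c x)" by (simp add: lts_functor_def)
  then show ?thesis using assms(3) by (simp add: lts_map_def)
qed

text \<open>\<open>cprod_map\<close> is extensional and naturality of \<open>\<alpha>\<close> is
  available on the coded product only, so successors must be located there before either can be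
  applied.\<close>

lemma succ_subset:
  assumes A: "coalgebra U (lts_functor L (gfunc T m)) (X, c)"
    and B: "coalgebra U (lts_functor L (gfunc T n)) (Y, d)" and st: "s \<in> X" "t \<in> Y" "\<mu> \<in> L"
  shows "succ (X, c) (Y, d) (pr (s, t)) \<mu> \<subseteq> pr ` (tobj T m X \<times> tobj T n Y)"
proof -
  have "c s \<nu> \<subseteq> tobj T m X" "d t \<nu> \<subseteq> tobj T n Y" if "\<nu> \<in> L" for \<nu>
    using coalgebraD(2)[OF A] coalgebraD(2)[OF B] st that by (auto simp: Fpow_def)
  moreover have "gpoint T m X s \<in> tobj T m X" "gpoint T n Y t \<in> tobj T n Y"
    using gpoint_type grade_elems coalgebraD(1)[OF A] coalgebraD(1)[OF B] st by auto
  moreover have "bar \<nu> \<in> L" if "\<nu> \<in> L - {\<tau>}" for \<nu> using bar_in[OF that] by simp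
  ultimately show ?thesis
    unfolding sync_succ_eq[OF inj_pr st] using st(3)
    by (intro image_mono Un_least Sigma_mono) (auto split: if_splits; blast)+
qed

text \<open>The idle component is handled by naturality of \<open>gpoint\<close>, the moving ones by
  the homomorphism law, one rule at a time. The equality holds for infinite sets as well, so
  finiteness of the successors of a pair passes to its image.\<close>

lemma succ_hom:
  assumes f: "coalgebra_hom U (lts_functor L (gfunc T m)) f (X, c) (Z, e)"
    and g: "coalgebra_hom U (lts_functor L (gfunc T n)) g (Y, d) (W, h)"
    and st: "s \<in> X" "t \<in> Y" "\<mu> \<in> L"
  shows "succ (Z, e) (W, h) (pr (f s, g t)) \<mu> =
    cprod_map pr (tobj T m X) (tobj T n Y) (tmor T m X Z f) (tmor T n Y W g) `
      succ (X, c) (Y, d) (pr (s, t)) \<mu>"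
proof -
  let ?\<Phi> = "map_prod (tmor T m X Z f) (tmor T n Y W g)"
  have co: "coalgebra U (lts_functor L (gfunc T m)) (X, c)" "coalgebra U (lts_functor L (gfunc T n)) (Y, d)"
    "X \<in> U" "Y \<in> U" "Z \<in> U" "W \<in> U" "f \<in> X \<rightarrow>\<^sub>E Z" "g \<in> Y \<rightarrow>\<^sub>E W"
    using f g by (auto simp: coalgebra_hom_def coalgebra_def)
  have fs: "f s \<in> Z" "g t \<in> W" using st PiE_mem[OF co(7)] PiE_mem[OF co(8)] by auto
  note e = coalgebra_homD[OF f st(1)] and h = coalgebra_homD[OF g st(2)]
  have gp: "gpoint T m Z (f s) = tmor T m X Z f (gpoint T m X s)"
    "gpoint T n W (g t) = tmor T n Y W g (gpoint T n Y t)"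
    using gpoint_natural[OF grade_elems(1) co(3,5,7) st(1)] gpoint_natural[OF grade_elems(2) co(4,6,8) st(2)]
    by auto
  have times: "?\<Phi> ` (A \<times> B) = (tmor T m X Z f ` A) \<times> (tmor T n Y W g ` B)" for A B
    by auto
  let ?R = "c s \<mu> \<times> {gpoint T n Y t} \<union> {gpoint T m X s} \<times> d t \<mu> \<union>
      (if \<mu> = \<tau> then \<Union>\<nu>\<in>L - {\<tau>}. c s \<nu> \<times> d t (bar \<nu>) else {})"
  \<comment> \<open>The homomorphism law is used at \<open>\<nu>\<close> on the left and at
    \<open>bar \<nu>\<close> on the right, which is again a label by \<open>bar_in\<close>.\<close>
  have un: "(\<Union>\<nu>\<in>L - {\<tau>}. e (f s) \<nu> \<times> h (g t) (bar \<nu>)) = ?\<Phi> ` (\<Union>\<nu>\<in>L - {\<tau>}. c s \<nu> \<times> d t (bar \<nu>))"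
    unfolding image_UN times
  proof (intro SUP_cong refl)
    fix \<nu> assume \<nu>: "\<nu> \<in> L - {\<tau>}"
    then show "e (f s) \<nu> \<times> h (g t) (bar \<nu>) = tmor T m X Z f ` c s \<nu> \<times> tmor T n Y W g ` d t (bar \<nu>)"
      using e[of \<nu>] h[of "bar \<nu>"] bar_in[OF \<nu>] by simp
  qed
  have "succ (Z, e) (W, h) (pr (f s, g t)) \<mu> = pr ` ?\<Phi> ` ?R"
    unfolding sync_succ_eq[OF inj_pr fs st(3)] image_Un times
    using un by (simp add: e[OF st(3)] h[OF st(3)] gp image_Un)
  also have "\<dots> = cprod_map pr (tobj T m X) (tobj T n Y) (tmor T m X Z f) (tmor T n Y W g) ` pr ` ?R"
  proof -
    have "pr ` ?R \<subseteq> pr ` (tobj T m X \<times> tobj T n Y)"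
      using succ_subset[OF co(1,2) st] unfolding sync_succ_eq[OF inj_pr st] .
    then have R: "?R \<subseteq> tobj T m X \<times> tobj T n Y" using inj_pr by (simp only: inj_image_subset_iff)
    show ?thesis unfolding image_image
    proof (intro image_cong refl)
      fix p assume "p \<in> ?R"
      then have "p \<in> tobj T m X \<times> tobj T n Y" using R by blast
      then show "pr (?\<Phi> p) =
          cprod_map pr (tobj T m X) (tobj T n Y) (tmor T m X Z f) (tmor T n Y W g) (pr p)"
        by (cases p) (auto simp: cprod_map_pr[OF inj_pr])
    qed
  qed
  finally show ?thesis unfolding sync_succ_eq[OF inj_pr st] .
qed

text \<open>In the cospan witnessing bisimilarity of the components, a pair of states can have infinitely many
  \<open>\<tau>\<close>-successors if \<open>L\<close> is infinite. Such a pair is not the image of a pair of states of the given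
  systems, so its transitions are irrelevant and can be dropped.\<close>

definition par_fin where
  "par_fin A B = (cprod pr (fst A) (fst B), \<lambda>p\<in>cprod pr (fst A) (fst B). \<lambda>\<mu>\<in>L.
     if finite (succ A B p \<mu>) then \<alpha> (fst A) (fst B) ` succ A B p \<mu> else {})"

lemma \<alpha>_image:
  assumes A: "coalgebra U (lts_functor L (gfunc T m)) (X, c)"
    and B: "coalgebra U (lts_functor L (gfunc T n)) (Y, d)"
    and st: "s \<in> X" "t \<in> Y" "\<mu> \<in> L" and fin: "finite (succ (X, c) (Y, d) (pr (s, t)) \<mu>)"
  shows "\<alpha> X Y ` succ (X, c) (Y, d) (pr (s, t)) \<mu> \<in> Fpow (tobj T (padd (grades T) m n) (cprod pr X Y))"
proof -
  have "\<alpha> X Y \<in> cprod pr (tobj T m X) (tobj T n Y) \<rightarrow>\<^sub>E tobj T (padd (grades T) m n) (cprod pr X Y)"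
    using pairing coalgebraD(1)[OF A] coalgebraD(1)[OF B] by (simp add: natural_pairing_def)
  from PiE_mem[OF this] show ?thesis
    using fin succ_subset[OF A B st] by (auto simp: Fpow_def cprod_def)
qed

lemma coalgebra_par_fin:
  assumes A: "coalgebra U (lts_functor L (gfunc T m)) A"
    and B: "coalgebra U (lts_functor L (gfunc T n)) B"
  shows "coalgebra U (lts_functor L (gfunc T (padd (grades T) m n))) (par_fin A B)"
proof -
  obtain X c Y d where AB: "A = (X, c)" "B = (Y, d)" by (cases A, cases B)
  note co = A[unfolded AB] B[unfolded AB]
  let ?d = "\<lambda>p \<mu>. if finite (succ (X, c) (Y, d) p \<mu>) then \<alpha> X Y ` succ (X, c) (Y, d) p \<mu> else {}"
  have "?d p \<mu> \<in> Fpow (tobj T (padd (grades T) m n) (cprod pr X Y))"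
    if "p \<in> cprod pr X Y" "\<mu> \<in> L" for p \<mu>
  proof -
    obtain s t where "p = pr (s, t)" "s \<in> X" "t \<in> Y" using \<open>p \<in> _\<close> by (auto simp: cprod_def)
    then show ?thesis
      using \<alpha>_image[OF co, of s t \<mu>] \<open>\<mu> \<in> L\<close> by (auto simp: AB Fpow_def)
  qed
  then have "(\<lambda>p\<in>cprod pr X Y. \<lambda>\<mu>\<in>L. ?d p \<mu>) \<in> cprod pr X Y \<rightarrow>\<^sub>E
      (L \<rightarrow>\<^sub>E Fpow (tobj T (padd (grades T) m n) (cprod pr X Y)))"
    by (intro restrict_PiE_iff[THEN iffD2] ballI)
  then show ?thesis
    using cprod_closed[OF coalgebraD(1)[OF co(1)] coalgebraD(1)[OF co(2)]]
    by (simp add: coalgebra_def par_fin_def AB lts_functor_def cong: if_cong)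
qed

lemma par_eq_par_fin:
  assumes "sync_defined pr T m n L \<tau> bar A B"
  shows "par pr T m n \<alpha> L \<tau> bar A B = par_fin A B"
    and "p \<in> cprod pr (fst A) (fst B) \<Longrightarrow> \<mu> \<in> L \<Longrightarrow> finite (succ A B p \<mu>)"
proof -
  show fin: "finite (succ A B p \<mu>)" if p: "p \<in> cprod pr (fst A) (fst B)" "\<mu> \<in> L" for p \<mu>
  proof -
    have "sync pr T m n L \<tau> bar A B p \<mu> \<in> Fpow (cprod pr (tobj T m (fst A)) (tobj T n (fst B)))"
      using PiE_mem[OF PiE_mem[OF assms[unfolded sync_defined_def] p(1)] p(2)] .
    then show ?thesis using p by (simp add: sync_def Fpow_def)
  qed
  show "par pr T m n \<alpha> L \<tau> bar A B = par_fin A B"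
    unfolding par_def par_fin_def
    by (auto simp: fin compose_def sync_def lts_map_def restrict_def fun_eq_iff)
qed

text \<open>Finite branching is assumed for the source only. At image pairs the target inherits it,
  so the guard in \<open>par_fin\<close> passes and the transitions are the genuine ones; naturality
  of \<open>\<alpha>\<close> then closes the square.\<close>

lemma coalgebra_hom_par:
  assumes f: "coalgebra_hom U (lts_functor L (gfunc T m)) f A A'"
    and g: "coalgebra_hom U (lts_functor L (gfunc T n)) g B B'"
    and def: "sync_defined pr T m n L \<tau> bar A B"
  shows "coalgebra_hom U (lts_functor L (gfunc T (padd (grades T) m n)))
    (cprod_map pr (fst A) (fst B) f g) (par pr T m n \<alpha> L \<tau> bar A B) (par_fin A' B')"
proof -
  obtain X c Y d Z e W h where AB: "A = (X, c)" "B = (Y, d)" "A' = (Z, e)" "B' = (W, h)"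
    by (cases A, cases B, cases A', cases B')
  note f' = f[unfolded AB] and g' = g[unfolded AB]
  let ?G = "lts_functor L (gfunc T (padd (grades T) m n))" and ?F = "cprod_map pr X Y f g"
  have co: "coalgebra U (lts_functor L (gfunc T m)) (X, c)" "coalgebra U (lts_functor L (gfunc T n)) (Y, d)"
    "coalgebra U (lts_functor L (gfunc T m)) (Z, e)" "coalgebra U (lts_functor L (gfunc T n)) (W, h)"
    and ty: "f \<in> X \<rightarrow>\<^sub>E Z" "g \<in> Y \<rightarrow>\<^sub>E W"
    using f' g' by (auto simp: coalgebra_hom_def)
  note U = co[THEN coalgebraD(1)]
  have fin: "finite (succ (X, c) (Y, d) (pr (s, t)) \<mu>)" if "s \<in> X" "t \<in> Y" "\<mu> \<in> L" for s t \<mu>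
    using par_eq_par_fin(2)[OF def, of "pr (s, t)" \<mu>] that by (simp add: AB cprod_def)
  have "mor ?G (cprod pr X Y) (cprod pr Z W) ?F (snd (par_fin A B) p) = snd (par_fin A' B') (?F p)"
    if p: "p \<in> cprod pr X Y" for p
  proof -
    obtain s t where st: "p = pr (s, t)" "s \<in> X" "t \<in> Y" using p by (auto simp: cprod_def)
    have Fp: "?F p = pr (f s, g t)" "?F p \<in> cprod pr Z W"
      using st cprod_map_pr[OF inj_pr] PiE_mem[OF cprod_map_type[OF inj_pr ty] p] by auto
    have "tmor T (padd (grades T) m n) (cprod pr X Y) (cprod pr Z W) ?F ` \<alpha> X Y ` succ (X, c) (Y, d) p \<mu> =
        \<alpha> Z W ` succ (Z, e) (W, h) (?F p) \<mu>" if \<mu>: "\<mu> \<in> L" for \<mu>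
    proof -
      have "tmor T (padd (grades T) m n) (cprod pr X Y) (cprod pr Z W) ?F (\<alpha> X Y z) =
          \<alpha> Z W (cprod_map pr (tobj T m X) (tobj T n Y) (tmor T m X Z f) (tmor T n Y W g) z)"
        if "z \<in> succ (X, c) (Y, d) p \<mu>" for z
      proof -
        have "z \<in> cprod pr (tobj T m X) (tobj T n Y)"
          using that succ_subset[OF co(1,2) st(2,3) \<mu>] unfolding st(1) cprod_def by blast
        then show ?thesis using pairing U ty unfolding natural_pairing_def by blast
      qed
      then show ?thesis
        unfolding Fp(1) succ_hom[OF f' g' st(2,3) \<mu>] unfolding st(1)[symmetric] image_image
        by (intro image_cong refl)
    qed
    \<comment> \<open>By \<open>succ_hom\<close> this set is the image of a finite set.\<close>
    moreover have "finite (succ (Z, e) (W, h) (?F p) \<mu>)" if "\<mu> \<in> L" for \<mu>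
      unfolding Fp(1) succ_hom[OF f' g' st(2,3) that] using fin[OF st(2,3) that] by simp
    moreover have "finite (succ (X, c) (Y, d) p \<mu>)" if "\<mu> \<in> L" for \<mu>
      unfolding st(1) by (rule fin[OF st(2,3) that])
    moreover have "snd (par_fin A B) p \<in> obj ?G (cprod pr X Y)"
      using coalgebra_par_fin[OF co(1,2)] PiE_mem[of "snd (par_fin A B)"] p
      by (auto simp: coalgebra_def AB par_fin_def)
    ultimately show ?thesis
      using p Fp(2) by (simp add: lts_functor_def lts_map_def par_fin_def AB cong: restrict_cong)
  qed
  then show ?thesis
    unfolding par_eq_par_fin(1)[OF def]
    using coalgebra_par_fin[OF co(1,2)] coalgebra_par_fin[OF co(3,4)] cprod_map_type[OF inj_pr ty]
    by (simp add: coalgebra_hom_def AB par_fin_def)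
qed

text \<open>The two cospans multiply. Their common apex \<open>par_fin (Z, e) (W, h)\<close> depends
  only on the given apexes, so both product legs land in the same coalgebra, and they agree on the
  coded pairs componentwise.\<close>

lemma kernel_bisimilar_par:
  assumes "kernel_bisimilar U (lts_functor L (gfunc T m)) A B s t"
    and "kernel_bisimilar U (lts_functor L (gfunc T n)) A' B' s' t'"
    and def: "sync_defined pr T m n L \<tau> bar A A'" "sync_defined pr T m n L \<tau> bar B B'"
  shows "kernel_bisimilar U (lts_functor L (gfunc T (padd (grades T) m n)))
    (par pr T m n \<alpha> L \<tau> bar A A') (par pr T m n \<alpha> L \<tau> bar B B') (pr (s, s')) (pr (t, t'))"
proof -
  obtain Z e f1 f2 where st: "s \<in> fst A" "t \<in> fst B" and
    f: "coalgebra_hom U (lts_functor L (gfunc T m)) f1 A (Z, e)"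
    "coalgebra_hom U (lts_functor L (gfunc T m)) f2 B (Z, e)" "f1 s = f2 t"
    using assms(1) by (auto simp: kernel_bisimilar_def)
  obtain W h g1 g2 where st': "s' \<in> fst A'" "t' \<in> fst B'" and
    g: "coalgebra_hom U (lts_functor L (gfunc T n)) g1 A' (W, h)"
    "coalgebra_hom U (lts_functor L (gfunc T n)) g2 B' (W, h)" "g1 s' = g2 t'"
    using assms(2) by (auto simp: kernel_bisimilar_def)
  have "cprod_map pr (fst A) (fst A') f1 g1 (pr (s, s')) = cprod_map pr (fst B) (fst B') f2 g2 (pr (t, t'))"
    using st st' f(3) g(3) by (simp add: cprod_map_pr[OF inj_pr])
  moreover have "pr (s, s') \<in> fst (par pr T m n \<alpha> L \<tau> bar A A')"
    "pr (t, t') \<in> fst (par pr T m n \<alpha> L \<tau> bar B B')"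
    using st st' by (auto simp: par_def cprod_def)
  moreover obtain V k where V: "par_fin (Z, e) (W, h) = (V, k)" by (cases "par_fin (Z, e) (W, h)")
  ultimately show ?thesis
    using coalgebra_hom_par[OF f(1) g(1) def(1)] coalgebra_hom_par[OF f(2) g(2) def(2)]
    unfolding kernel_bisimilar_def V by blast
qed

end

lemma kernel_bisimilar_parallel:
  assumes "set_universe U pr" "extensible_graded_monad U T" "perp (grades T) m n"
    "natural_pairing U pr T m n \<alpha>" "sync_labels L \<tau> bar"
    and "kernel_bisimilar U (lts_functor L (gfunc T m)) A B s t"
    and "kernel_bisimilar U (lts_functor L (gfunc T n)) A' B' s' t'"
    and "sync_defined pr T m n L \<tau> bar A A'" "sync_defined pr T m n L \<tau> bar B B'"
  shows "kernel_bisimilar U (lts_functor L (gfunc T (padd (grades T) m n)))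
    (par pr T m n \<alpha> L \<tau> bar A A') (par pr T m n \<alpha> L \<tau> bar B B') (pr (s, s')) (pr (t, t'))"
proof -
  interpret graded_parallel U pr T L \<tau> bar m n \<alpha>
    by (intro graded_parallel.intro graded_parallel_axioms.intro assms)
  show ?thesis by (rule kernel_bisimilar_par) (fact assms)+
qed

theorem mainTheorem11:
  fixes U :: "'u set set" and pr :: "'u \<times> 'u \<Rightarrow> 'u"
  assumes "set_universe U pr"
  shows
    "(\<forall>(Sys :: 's::linorder set) dims C C' (L :: 'l set) \<rho> X c Y d s t.
        finite Sys \<and> C \<subseteq> Sys \<and> C' \<subseteq> C \<and> \<rho> \<in> density (hdim dims C') \<and>
        coalgebra U (qlts_functor dims C L) (X, c) \<and>
        coalgebra U (qlts_functor dims C L) (Y, d) \<and>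
        s \<in> X \<and> t \<in> Y \<and>
        kernel_bisimilar U (qlts_functor dims C L) (X, c) (Y, d) s t \<longrightarrow>
        kernel_bisimilar U (qlts_functor dims (C - C') L)
          (qlts_partial_eval dims C C' \<rho> L (X, c)) (qlts_partial_eval dims C C' \<rho> L (Y, d)) s t)
     \<and>
     (\<forall>(T :: ('m, 'u) graded_monad) m n \<alpha> (L :: 'l set) \<tau> bar X c Y d X' c' Y' d' s t s' t'.
        extensible_graded_monad U T \<and> perp (grades T) m n \<and> natural_pairing U pr T m n \<alpha> \<and>
        sync_labels L \<tau> bar \<and>
        coalgebra U (lts_functor L (gfunc T m)) (X, c) \<and>
        coalgebra U (lts_functor L (gfunc T m)) (Y, d) \<and>
        s \<in> X \<and> t \<in> Y \<and>
        kernel_bisimilar U (lts_functor L (gfunc T m)) (X, c) (Y, d) s t \<and>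
        coalgebra U (lts_functor L (gfunc T n)) (X', c') \<and>
        coalgebra U (lts_functor L (gfunc T n)) (Y', d') \<and>
        s' \<in> X' \<and> t' \<in> Y' \<and>
        kernel_bisimilar U (lts_functor L (gfunc T n)) (X', c') (Y', d') s' t' \<and>
        sync_defined pr T m n L \<tau> bar (X, c) (X', c') \<and>
        sync_defined pr T m n L \<tau> bar (Y, d) (Y', d') \<longrightarrow>
        kernel_bisimilar U (lts_functor L (gfunc T (padd (grades T) m n)))
          (par pr T m n \<alpha> L \<tau> bar (X, c) (X', c')) (par pr T m n \<alpha> L \<tau> bar (Y, d) (Y', d'))
          (pr (s, s')) (pr (t, t')))"
proof (intro conjI allI impI, goal_cases)
  case (1 Sys dims C C' L \<rho> X c Y d s t)
  then show ?case
    by (elim conjE) (rule kernel_bisimilar_partial_eval[OF finite_subset]; assumption)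
next
  case (2 T m n \<alpha> L \<tau> bar X c Y d X' c' Y' d' s t s' t')
  then show ?case
    by (elim conjE) (rule kernel_bisimilar_parallel[OF assms]; assumption)
qed

end
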